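(* Let $C_E$ be the edit cost function with vertex insertion cost $0$, vertex deletion cost $0$, vertex relabeling cost $\infty$, edge insertion cost $1$, edge deletion cost $1$, and edge relabeling cost $2$. There is a polynomial-time algorithm that, given two unlabeled graphs $G_1$ and $G_2$ such that $G_1$ is a path and $G_2$ is a tree, computes the graph edit distance $\mathrm{GED}(G_1,G_2;C_E)$. (Equivalently, for labeled graphs, the same holds for the cost function obtained from $C_E$ by setting the vertex and edge relabeling costs to $0$.)
   Context: Graphs are finite, simple and undirected; trees are unrooted and unordered. A labeled graph is a graph $G=(V,E)$ with a labeling function $\ell\colon V\cup E\to\Sigma$, where $\Sigma$ is a finite alphabet; unlabeled graphs are graphs without labels (equivalently, all vertices carry one common label and all edges carry one common label, so no relabeling ever occurs). Isomorphisms preserve adjacency, non-adjacency, and all labels. Graph edit distance. An edit operation is an insertion, deletion, or relabeling of a vertex or an edge, with a non-negative cost given by a cost function $C$; the relabeling cost is charged when the labels do not match (leaving a label unchanged costs $0$). An edit path $\gamma=(o_1,\dots,o_k)$ from $G_1$ to $G_2$ is a sequence of edit operations transforming $G_1$ into a graph isomorphic to $G_2$ (intermediate graphs may be arbitrary graphs), with cost $C(\gamma)=\sum_i C(o_i)$. A restricted edit path is an edit path in which a vertex can only be deleted after its incident edges have been deleted, an edge can only be inserted if its endpoints exist, each vertex and each edge is edited at most once, and deleting and reinserting an edge between relabeled (i.e. substituted) vertices is forbidden. Then $\mathrm{GED}(G_1,G_2;C)=\min_{\gamma} C(\gamma)$ over all restricted edit paths $\gamma$ from $G_1$ to $G_2$.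 It is a known fact that this is equivalent to the node map formulation: the minimum, over all bijections $\phi$ from a subset $U_1\subseteq V_1$ to a subset $U_2\subseteq V_2$, of the total induced cost, where vertices in $U_1$ are mapped (relabeled if the labels differ), vertices of $V_1\setminus U_1$ are deleted, vertices of $V_2\setminus U_2$ are inserted, an edge $(u,v)\in E_1$ with $u,v\in U_1$ and $(\phi(u),\phi(v))\in E_2$ is kept (relabeled if the labels differ), all other edges of $E_1$ are deleted, and all other edges of $E_2$ are inserted. *)

theory Defs
  imports
    "HOL-Library.Extended_Nonnegative_Real"
    "HOL-Computational_Algebra.Polynomial"
begin

section \<open>Labeled graphs\<close>

text \<open>
  An edge is its two-element set of endpoints. The labelings are total functions; only their
  values on the vertices and edges of the graph matter. An unlabeled graph is a graph over the
  one-element label type \<^typ>\<open>unit\<close>.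
\<close>

record ('v, 'l) lgraph =
  verts :: "'v set"
  edges :: "'v set set"
  vlab :: "'v \<Rightarrow> 'l"
  elab :: "'v set \<Rightarrow> 'l"

definition is_graph :: "('v, 'l) lgraph \<Rightarrow> bool" where
  "is_graph G \<longleftrightarrow> finite (verts G) \<and>
     (\<forall>e \<in> edges G. \<exists>u \<in> verts G. \<exists>v \<in> verts G. u \<noteq> v \<and> e = {u, v})"

definition labels :: "('v, 'l) lgraph \<Rightarrow> 'l set" where
  "labels G = vlab G ` verts G \<union> elab G ` edges G"

definition isomorphic :: "('v, 'l) lgraph \<Rightarrow> ('w, 'l) lgraph \<Rightarrow> bool" where
  "isomorphic G H \<longleftrightarrow> (\<exists>f. bij_betw f (verts G) (verts H) \<and>
     (\<forall>u \<in> verts G. \<forall>v \<in> verts G. {u, v} \<in> edges G \<longleftrightarrow> {f u, f v} \<in> edges H) \<and>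
     (\<forall>v \<in> verts G. vlab H (f v) = vlab G v) \<and>
     (\<forall>e \<in> edges G. elab H (f ` e) = elab G e))"

definition is_path :: "('v, 'l) lgraph \<Rightarrow> bool" where
  "is_path G \<longleftrightarrow> (\<exists>vs. vs \<noteq> [] \<and> distinct vs \<and> verts G = set vs \<and>
     edges G = {{vs ! i, vs ! Suc i} | i. Suc i < length vs})"

definition connected_graph :: "('v, 'l) lgraph \<Rightarrow> bool" where
  "connected_graph G \<longleftrightarrow> verts G \<noteq> {} \<and>
     (\<forall>u \<in> verts G. \<forall>v \<in> verts G. (u, v) \<in> {(x, y). {x, y} \<in> edges G}\<^sup>*)"

definition is_cycle_in :: "('v, 'l) lgraph \<Rightarrow> 'v list \<Rightarrow> bool" where
  "is_cycle_in G vs \<longleftrightarrow> 3 \<le> length vs \<and> distinct vs \<and>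
     (\<forall>i. Suc i < length vs \<longrightarrow> {vs ! i, vs ! Suc i} \<in> edges G) \<and> {last vs, hd vs} \<in> edges G"

definition is_tree :: "('v, 'l) lgraph \<Rightarrow> bool" where
  "is_tree G \<longleftrightarrow> is_graph G \<and> connected_graph G \<and> (\<nexists>vs. is_cycle_in G vs)"


section \<open>Graph edit distance\<close>

text \<open>
  A relabeling carries the old and the new label, so that the cost of an operation depends on the
  operation alone.
\<close>

datatype ('v, 'l) edit_op =
    VIns 'v 'l
  | VDel 'v
  | VRel 'v 'l 'l
  | EIns "'v set" 'l
  | EDel "'v set"
  | ERel "'v set" 'l 'l

text \<open>
  The conditions on the vertices in \<open>VDel\<close> (all incident edges are already gone) and \<open>EIns\<close> (both
  endpoints exist) are those of restricted edit paths.
\<close>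

fun applicable :: "('v, 'l) lgraph \<Rightarrow> ('v, 'l) edit_op \<Rightarrow> bool" where
  "applicable G (VIns v a) \<longleftrightarrow> v \<notin> verts G"
| "applicable G (VDel v) \<longleftrightarrow> v \<in> verts G \<and> (\<forall>e \<in> edges G. v \<notin> e)"
| "applicable G (VRel v a b) \<longleftrightarrow> v \<in> verts G \<and> vlab G v = a"
| "applicable G (EIns e a) \<longleftrightarrow>
     e \<notin> edges G \<and> (\<exists>u \<in> verts G. \<exists>v \<in> verts G. u \<noteq> v \<and> e = {u, v})"
| "applicable G (EDel e) \<longleftrightarrow> e \<in> edges G"
| "applicable G (ERel e a b) \<longleftrightarrow> e \<in> edges G \<and> elab G e = a"

fun apply_op :: "('v, 'l) lgraph \<Rightarrow> ('v, 'l) edit_op \<Rightarrow> ('v, 'l) lgraph" where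
  "apply_op G (VIns v a) = G\<lparr>verts := insert v (verts G), vlab := (vlab G)(v := a)\<rparr>"
| "apply_op G (VDel v) = G\<lparr>verts := verts G - {v}\<rparr>"
| "apply_op G (VRel v a b) = G\<lparr>vlab := (vlab G)(v := b)\<rparr>"
| "apply_op G (EIns e a) = G\<lparr>edges := insert e (edges G), elab := (elab G)(e := a)\<rparr>"
| "apply_op G (EDel e) = G\<lparr>edges := edges G - {e}\<rparr>"
| "apply_op G (ERel e a b) = G\<lparr>elab := (elab G)(e := b)\<rparr>"

fun all_applicable :: "('v, 'l) lgraph \<Rightarrow> ('v, 'l) edit_op list \<Rightarrow> bool" where
  "all_applicable G [] \<longleftrightarrow> True"
| "all_applicable G (x # xs) \<longleftrightarrow> applicable G x \<and> all_applicable (apply_op G x) xs"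

fun edited :: "('v, 'l) edit_op \<Rightarrow> 'v + 'v set" where
  "edited (VIns v a) = Inl v"
| "edited (VDel v) = Inl v"
| "edited (VRel v a b) = Inl v"
| "edited (EIns e a) = Inr e"
| "edited (EDel e) = Inr e"
| "edited (ERel e a b) = Inr e"

text \<open>
  Every vertex and every edge is edited at most once. As an edge is identified with its set of
  endpoints, an edge that is deleted and reinserted between the same two vertices is edited twice;
  so this also rules out the deletion and reinsertion of an edge between substituted vertices.
  Conversely, a vertex inserted in place of a deleted one has to take a fresh name, so the type of
  vertices should be infinite.
\<close>

definition restricted_edit_path ::
    "('v, 'l) lgraph \<Rightarrow> ('w, 'l) lgraph \<Rightarrow> ('v, 'l) edit_op list \<Rightarrow> bool" where
  "restricted_edit_path G H \<gamma> \<longleftrightarrow>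
     all_applicable G \<gamma> \<and> isomorphic (foldl apply_op G \<gamma>) H \<and> distinct (map edited \<gamma>)"

definition path_cost :: "(('v, 'l) edit_op \<Rightarrow> ennreal) \<Rightarrow> ('v, 'l) edit_op list \<Rightarrow> ennreal" where
  "path_cost C \<gamma> = (\<Sum>x\<leftarrow>\<gamma>. C x)"

definition GED ::
    "('v, 'l) lgraph \<Rightarrow> ('w, 'l) lgraph \<Rightarrow> (('v, 'l) edit_op \<Rightarrow> ennreal) \<Rightarrow> ennreal" where
  "GED G H C = (INF \<gamma> \<in> {\<gamma>. restricted_edit_path G H \<gamma>}. path_cost C \<gamma>)"

text \<open>The arguments are the costs of vertex insertion, deletion and relabeling, then of edge
  insertion, deletion and relabeling.\<close>

fun uniform_cost ::
    "ennreal \<Rightarrow> ennreal \<Rightarrow> ennreal \<Rightarrow> ennreal \<Rightarrow> ennreal \<Rightarrow> ennreal \<Rightarrow> ('v, 'l) edit_op \<Rightarrow> ennreal"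
where
  "uniform_cost vi vd vr ei ed er (VIns v a) = vi"
| "uniform_cost vi vd vr ei ed er (VDel v) = vd"
| "uniform_cost vi vd vr ei ed er (VRel v a b) = (if a = b then 0 else vr)"
| "uniform_cost vi vd vr ei ed er (EIns e a) = ei"
| "uniform_cost vi vd vr ei ed er (EDel e) = ed"
| "uniform_cost vi vd vr ei ed er (ERel e a b) = (if a = b then 0 else er)"

definition C_E :: "('v, 'l) edit_op \<Rightarrow> ennreal" where
  "C_E = uniform_cost 0 0 \<infinity> 1 1 2"

definition C_E_free_relabeling :: "('v, 'l) edit_op \<Rightarrow> ennreal" where
  "C_E_free_relabeling = uniform_cost 0 0 0 1 1 0"


section \<open>Polynomial-time algorithms\<close>

text \<open>
  Algorithms are structured programs for a random access machine. The memory consists of named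
  arrays of natural numbers (a scalar is the cell 0 of an array), and arrays may be accessed at
  computed addresses. The only arithmetic operations are addition and truncated subtraction.

  Every assignment and every test takes one unit of time; as the expressions of a program have
  bounded size, this agrees up to a constant factor with counting single operations. In the
  absence of multiplication, \<open>t\<close> steps produce only numbers whose bit length exceeds that of the
  input by \<open>O(t)\<close>, so that polynomial time here is polynomial time on Turing machines.
\<close>

type_synonym state = "string \<Rightarrow> nat \<Rightarrow> nat"

datatype aexp = N nat | Acc string aexp | Plus aexp aexp | Minus aexp aexp

fun aval :: "aexp \<Rightarrow> state \<Rightarrow> nat" where
  "aval (N n) s = n"
| "aval (Acc x a) s = s x (aval a s)"
| "aval (Plus a b) s = aval a s + aval b s"
| "aval (Minus a b) s = aval a s - aval b s"

datatype bexp = Less aexp aexp | Eq aexp aexp | Not bexp | And bexp bexp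

fun bval :: "bexp \<Rightarrow> state \<Rightarrow> bool" where
  "bval (Less a b) s \<longleftrightarrow> aval a s < aval b s"
| "bval (Eq a b) s \<longleftrightarrow> aval a s = aval b s"
| "bval (Not b) s \<longleftrightarrow> \<not> bval b s"
| "bval (And b c) s \<longleftrightarrow> bval b s \<and> bval c s"

datatype com =
    Skip
  | Assign string aexp aexp  (* Assign x a b: x[a] := b *)
  | Seq com com
  | If bexp com com
  | While bexp com

text \<open>\<open>exec c s t s'\<close>: program \<open>c\<close> started in \<open>s\<close> terminates in \<open>s'\<close> after \<open>t\<close> time units.\<close>

inductive exec :: "com \<Rightarrow> state \<Rightarrow> nat \<Rightarrow> state \<Rightarrow> bool" where
  Skip: "exec Skip s 1 s"
| Assign: "exec (Assign x a b) s 1 (s(x := (s x)(aval a s := aval b s)))"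
| Seq: "exec c s t s' \<Longrightarrow> exec d s' u s'' \<Longrightarrow> exec (Seq c d) s (t + u) s''"
| IfTrue: "bval b s \<Longrightarrow> exec c s t s' \<Longrightarrow> exec (If b c d) s (Suc t) s'"
| IfFalse: "\<not> bval b s \<Longrightarrow> exec d s t s' \<Longrightarrow> exec (If b c d) s (Suc t) s'"
| WhileFalse: "\<not> bval b s \<Longrightarrow> exec (While b c) s 1 s"
| WhileTrue: "bval b s \<Longrightarrow> exec c s t s' \<Longrightarrow> exec (While b c) s' u s'' \<Longrightarrow>
    exec (While b c) s (Suc (t + u)) s''"

inductive_cases exec_SkipE: "exec Skip s t s'"
inductive_cases exec_AssignE: "exec (Assign x a b) s t s'"
inductive_cases exec_SeqE: "exec (Seq c d) s t s'"
inductive_cases exec_IfE: "exec (If b c d) s t s'"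
inductive_cases exec_WhileE: "exec (While b c) s t s'"

lemma exec_deterministic:
  "exec c s t s' \<Longrightarrow> exec c s u s'' \<Longrightarrow> u = t \<and> s'' = s'"
proof (induction arbitrary: u s'' rule: exec.induct)
  case Skip
  then show ?case by (elim exec_SkipE) simp
next
  case Assign
  then show ?case by (elim exec_AssignE) simp
next
  case Seq
  from Seq.prems show ?case by (elim exec_SeqE) (use Seq.IH in blast)
next
  case IfTrue
  from IfTrue.prems show ?case by (elim exec_IfE) (use IfTrue.IH IfTrue.hyps in blast)+
next
  case IfFalse
  from IfFalse.prems show ?case by (elim exec_IfE) (use IfFalse.IH IfFalse.hyps in blast)+
next
  case WhileFalse
  from WhileFalse.prems show ?case
    by (rule exec_WhileE) (use WhileFalse.hyps in simp_all)
next
  case WhileTrue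
  from WhileTrue.prems show ?case
    by (rule exec_WhileE) (use WhileTrue.IH WhileTrue.hyps in blast)+
qed

definition input_state :: "nat list \<Rightarrow> state" where
  "input_state w = (\<lambda>x i.
     if x = ''in'' then (if i < length w then w ! i else 0)
     else if x = ''len'' \<and> i = 0 then length w
     else 0)"

text \<open>
  The running time is measured against the number of entries of the input, which never exceeds
  the total length of their binary representations. The program need only work on the instances in \<open>D\<close>.
\<close>

definition poly_time_computable ::
    "('i \<Rightarrow> nat list) \<Rightarrow> 'i set \<Rightarrow> ('i \<Rightarrow> 'r::semiring_1) \<Rightarrow> bool" where
  "poly_time_computable enc D f \<longleftrightarrow> (\<exists>c (p :: nat poly). \<forall>x \<in> D. \<exists>t s.
     exec c (input_state (enc x)) t s \<and> t \<le> poly p (length (enc x)) \<and>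
     of_nat (s ''out'' 0) = f x)"

text \<open>
  Input graphs have vertex set \<open>{..<n}\<close>. A graph is given by \<open>n\<close>, the list of its vertex
  labels, and its adjacency matrix in row-major order, where an edge with label code \<open>a\<close> is
  represented by \<open>Suc a\<close> and a non-edge by 0.
\<close>

definition input_graph :: "(nat, 'l) lgraph \<Rightarrow> bool" where
  "input_graph G \<longleftrightarrow> is_graph G \<and> verts G = {..<card (verts G)}"

definition encode_graph :: "('l \<Rightarrow> nat) \<Rightarrow> (nat, 'l) lgraph \<Rightarrow> nat list" where
  "encode_graph code G = (let n = card (verts G) in
     n # map (\<lambda>v. code (vlab G v)) [0..<n] @
     concat (map (\<lambda>u. map (\<lambda>v. if {u, v} \<in> edges G then Suc (code (elab G {u, v})) else 0) [0..<n])
       [0..<n]))"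

fun encode_pair :: "('l \<Rightarrow> nat) \<Rightarrow> (nat, 'l) lgraph \<times> (nat, 'l) lgraph \<Rightarrow> nat list" where
  "encode_pair code (G, H) = encode_graph code G @ encode_graph code H"

definition path_tree_pairs :: "((nat, 'l) lgraph \<times> (nat, 'l) lgraph) set" where
  "path_tree_pairs =
     {(G\<^sub>1, G\<^sub>2). input_graph G\<^sub>1 \<and> is_path G\<^sub>1 \<and> input_graph G\<^sub>2 \<and> is_tree G\<^sub>2}"

end

theory Submission
  imports Defs
begin

text \<open>
  As vertices are edited and labels are changed for free, the distance is the minimum, over all copies
  \<open>F\<close> of \<open>G\<^sub>2\<close>, of the size of the symmetric difference of the edge sets of \<open>G\<^sub>1\<close> and \<open>F\<close>. So the number
  of common edges has to be maximized. A set of edges of a tree can be placed on a path with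
  \<open>n\<close> vertices iff all its degrees are at most 2 and it covers at most \<open>n\<close> vertices. The maximum size
  of such a set is found by dynamic programming over the tree, with the degree of the root and the
  number of covered vertices as parameters. The order in which the vertices are processed comes from
  a search of the tree; since there are no cycles, the search uses every edge.
\<close>

section \<open>Running times and total correctness of programs\<close>

text \<open>Vertices in an edit path carry names, and a vertex that keeps its name is a substituted
  one; so a node map amounts to the way in which a copy \<open>F\<close> of the tree overlaps the
  path. The number of covered vertices matters because the pieces of a forest must lie disjointly on
  the path: \<open>e\<close> edges in \<open>c\<close> pieces take \<open>e + c\<close> vertices.
  Uncovered tree vertices cost nothing and get fresh names. Besides that number only the degree of
  the root has to be remembered, since it also tells whether the root is covered. With
  \<open>best - 1\<close> the largest number of common edges, the distance is
  \<open>(n - 1) + (m - 1) - 2 * (best - 1) = n + m - 2 * best\<close>; the offset by one also frees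
  the value 0 for "no forest". Every loop counts up to a bound that it does not change and that is
  linear in the input length, so polynomial running time follows from the shape of the program
  alone.\<close>

text \<open>This bounds the running time if no loop makes more than \<open>L\<close> iterations.\<close>

fun time_bound :: "nat \<Rightarrow> com \<Rightarrow> nat" where
  "time_bound L Skip = 1"
| "time_bound L (Assign x a b) = 1"
| "time_bound L (Seq c d) = time_bound L c + time_bound L d"
| "time_bound L (If b c d) = Suc (time_bound L c + time_bound L d)"
| "time_bound L (While b c) = Suc (L * Suc (time_bound L c))"

text \<open>For a fixed program the nesting depth of its loops bounds the degree. What remains to be
  shown about running times is a bound on the iterations of each single loop.\<close>

lemma time_bound_poly: "\<exists>p. \<forall>L. time_bound L c = poly p L"
proof (induction c)
  case Skip
  show ?case by (rule exI[of _ "[:1:]"]) simp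
next
  case (Assign x a b)
  show ?case by (rule exI[of _ "[:1:]"]) simp
next
  case (Seq c d)
  then obtain p q where "\<forall>L. time_bound L c = poly p L" "\<forall>L. time_bound L d = poly q L"
    by blast
  then show ?case by (intro exI[of _ "p + q"]) simp
next
  case (If b c d)
  then obtain p q where "\<forall>L. time_bound L c = poly p L" "\<forall>L. time_bound L d = poly q L"
    by blast
  then show ?case by (intro exI[of _ "[:1:] + p + q"]) simp
next
  case (While b c)
  then obtain p where "\<forall>L. time_bound L c = poly p L"
    by blast
  then show ?case by (intro exI[of _ "[:1:] + [:0, 1:] * ([:1:] + p)"]) simp
qed

section \<open>Frames and total correctness with a time bound\<close>

fun writes :: "com \<Rightarrow> string set" where
  "writes Skip = {}"
| "writes (Assign x a b) = {x}"
| "writes (Seq c d) = writes c \<union> writes d"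
| "writes (If b c d) = writes c \<union> writes d"
| "writes (While b c) = writes c"

lemma exec_writes: "exec c s t s' \<Longrightarrow> x \<notin> writes c \<Longrightarrow> s' x = s x"
  by (induction rule: exec.induct) auto

fun reads :: "aexp \<Rightarrow> string set" where
  "reads (N n) = {}"
| "reads (Acc x a) = insert x (reads a)"
| "reads (Plus a b) = reads a \<union> reads b"
| "reads (Minus a b) = reads a \<union> reads b"

lemma aval_reads: "(\<And>x. x \<in> reads a \<Longrightarrow> s x = s' x) \<Longrightarrow> aval a s = aval a s'"
  by (induction a) auto

text \<open>Termination, the time bound and the postcondition are bundled, with one \<open>L\<close>
  for all loops, so that no separate analysis of running times is necessary.\<close>

definition wp :: "nat \<Rightarrow> com \<Rightarrow> (state \<Rightarrow> bool) \<Rightarrow> state \<Rightarrow> bool" where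
  "wp L c Q s \<longleftrightarrow> (\<exists>t s'. exec c s t s' \<and> t \<le> time_bound L c \<and> Q s')"

lemma wp_Skip: "Q s \<Longrightarrow> wp L Skip Q s"
  unfolding wp_def by (intro exI[of _ 1] exI[of _ s]) (use exec.Skip in auto)

lemma wp_Assign: "Q (s(x := (s x)(aval a s := aval b s))) \<Longrightarrow> wp L (Assign x a b) Q s"
  unfolding wp_def
  by (intro exI[of _ 1] exI[of _ "s(x := (s x)(aval a s := aval b s))"])
    (use exec.Assign in auto)

lemma wp_Seq: "wp L c (wp L d Q) s \<Longrightarrow> wp L (Seq c d) Q s"
proof -
  assume "wp L c (wp L d Q) s"
  then obtain t s' u s'' where "exec c s t s'" "t \<le> time_bound L c"
    "exec d s' u s''" "u \<le> time_bound L d" "Q s''"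
    unfolding wp_def by blast
  then show ?thesis
    unfolding wp_def by (intro exI[of _ "t + u"] exI[of _ s'']) (auto intro: exec.Seq)
qed

lemma wp_If: "(bval b s \<Longrightarrow> wp L c Q s) \<Longrightarrow> (\<not> bval b s \<Longrightarrow> wp L d Q s) \<Longrightarrow> wp L (If b c d) Q s"
proof (cases "bval b s")
  case True
  assume "bval b s \<Longrightarrow> wp L c Q s"
  with True obtain t s' where "exec c s t s'" "t \<le> time_bound L c" "Q s'"
    unfolding wp_def by blast
  with True show ?thesis
    unfolding wp_def by (intro exI[of _ "Suc t"] exI[of _ s']) (auto intro: exec.IfTrue)
next
  case False
  assume "\<not> bval b s \<Longrightarrow> wp L d Q s"
  with False obtain t s' where "exec d s t s'" "t \<le> time_bound L d" "Q s'"
    unfolding wp_def by blast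
  with False show ?thesis
    unfolding wp_def by (intro exI[of _ "Suc t"] exI[of _ s']) (auto intro: exec.IfFalse)
qed

text \<open>Specifications can be confined to the arrays that a phase changes; everything else is
  recovered from \<open>writes\<close>.\<close>

lemma wp_frame:
  assumes "wp L c Q s" "\<And>s'. Q s' \<Longrightarrow> (\<And>x. x \<notin> writes c \<Longrightarrow> s' x = s x) \<Longrightarrow> R s'"
  shows "wp L c R s"
  using assms exec_writes unfolding wp_def by blast

section \<open>Counting loops\<close>

abbreviation Sc :: "string \<Rightarrow> aexp" where
  "Sc x \<equiv> Acc x (N 0)"

abbreviation Let_Sc :: "string \<Rightarrow> aexp \<Rightarrow> com"  (infix "::=" 70) where
  "x ::= a \<equiv> Assign x (N 0) a"

abbreviation seq_com :: "com \<Rightarrow> com \<Rightarrow> com"  (infixr ";;" 60) where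
  "c ;; d \<equiv> Seq c d"

definition For :: "string \<Rightarrow> aexp \<Rightarrow> com \<Rightarrow> com" where
  "For x bnd c = x ::= N 0 ;; While (Less (Sc x) bnd) (c ;; x ::= Plus (Sc x) (N 1))"

lemma writes_For [simp]: "writes (For x bnd c) = insert x (writes c)"
  by (auto simp: For_def)

text \<open>The bound reads nothing that the loop writes, and the body leaves the counter alone, so
  there are exactly \<open>n\<close> iterations. \<open>step\<close> and \<open>final\<close>
  provide the frame relative to the initial state; hence \<open>I\<close> need only describe what
  the loop changes.\<close>

lemma wp_For:
  assumes bnd: "aval bnd s\<^sub>0 = n" "n \<le> L" "reads bnd \<inter> insert x (writes c) = {}" "x \<notin> writes c"
    and init: "I 0 (s\<^sub>0(x := (s\<^sub>0 x)(0 := 0)))"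
    and step: "\<And>i s. i < n \<Longrightarrow> I i s \<Longrightarrow> s x 0 = i \<Longrightarrow> (\<And>y. y \<notin> insert x (writes c) \<Longrightarrow> s y = s\<^sub>0 y) \<Longrightarrow>
      wp L c (\<lambda>s'. I (Suc i) (s'(x := (s' x)(0 := Suc i)))) s"
    and final: "\<And>s. I n s \<Longrightarrow> (\<And>y. y \<notin> insert x (writes c) \<Longrightarrow> s y = s\<^sub>0 y) \<Longrightarrow> Q s"
  shows "wp L (For x bnd c) Q s\<^sub>0"
proof -
  let ?body = "c ;; x ::= Plus (Sc x) (N 1)"
  let ?loop = "While (Less (Sc x) bnd) ?body"
  let ?frame = "\<lambda>s. \<forall>y. y \<notin> insert x (writes c) \<longrightarrow> s y = s\<^sub>0 y"
  have bnd_eq: "aval bnd s = n" if "?frame s" for s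
    using aval_reads[of bnd s s\<^sub>0] that bnd by blast
  \<comment> \<open>Induction on the number \<open>k\<close> of iterations still to come, with the
    counter at \<open>n - k\<close>.\<close>
  have loop: "\<exists>t s'. exec ?loop s t s' \<and> t \<le> Suc (k * Suc (time_bound L ?body)) \<and> I n s' \<and> ?frame s'"
    if "I (n - k) s" "k \<le> n" "s x 0 = n - k" "?frame s" for k s
    using that
  proof (induction k arbitrary: s)
    case 0
    then have "\<not> bval (Less (Sc x) bnd) s"
      using bnd_eq by simp
    then show ?case
      using 0 exec.WhileFalse[of "Less (Sc x) bnd" s ?body]
      by (intro exI[of _ 1] exI[of _ s]) simp
  next
    case (Suc k)
    define i where "i = n - Suc k"
    have i: "i < n" "Suc i = n - k" "s x 0 = i" "I i s"
      using Suc.prems by (auto simp: i_def)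
    have "wp L c (\<lambda>s'. I (Suc i) (s'(x := (s' x)(0 := Suc i)))) s"
      using step[OF i(1,4,3)] Suc.prems(4) by blast
    then obtain t s' where 1: "exec c s t s'" "t \<le> time_bound L c"
      "I (Suc i) (s'(x := (s' x)(0 := Suc i)))"
      unfolding wp_def by blast
    define s2 where "s2 = s'(x := (s' x)(0 := Suc i))"
    have unch: "\<And>y. y \<notin> writes c \<Longrightarrow> s' y = s y"
      using exec_writes[OF 1(1)] by blast
    have "s' x 0 = i"
      using unch[of x] i bnd by simp
    then have "exec (x ::= Plus (Sc x) (N 1)) s' 1 s2"
      using exec.Assign[of x "N 0" "Plus (Sc x) (N 1)" s'] by (simp add: s2_def)
    then have 2: "exec ?body s (t + 1) s2"
      using 1 exec.Seq by blast
    have fr: "?frame s2"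
      using unch Suc.prems(4) by (auto simp: s2_def)
    have inv: "I (n - k) s2" "s2 x 0 = n - k"
      using 1(3) i(2) by (simp_all add: s2_def)
    obtain t' s'' where 3: "exec ?loop s2 t' s''" "t' \<le> Suc (k * Suc (time_bound L ?body))"
      "I n s''" "?frame s''"
      using Suc.IH[OF _ _ _ fr] inv Suc.prems(2) by auto
    have "bval (Less (Sc x) bnd) s"
      using bnd_eq[OF Suc.prems(4)] i by simp
    then have "exec ?loop s (Suc ((t + 1) + t')) s''"
      using 2 3 exec.WhileTrue by blast
    moreover have "Suc ((t + 1) + t') \<le> Suc (Suc k * Suc (time_bound L ?body))"
      using 1 3 by simp
    ultimately show ?case
      using 3 by blast
  qed
  define s1 where "s1 = s\<^sub>0(x := (s\<^sub>0 x)(0 := 0))"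
  obtain t s' where r: "exec ?loop s1 t s'" "t \<le> Suc (n * Suc (time_bound L ?body))" "I n s'" "?frame s'"
    using loop[of n s1] init by (auto simp: s1_def)
  have "exec (x ::= N 0) s\<^sub>0 1 s1"
    using exec.Assign[of x "N 0" "N 0" s\<^sub>0] by (simp add: s1_def)
  then have "exec (For x bnd c) s\<^sub>0 (1 + t) s'"
    unfolding For_def using r(1) by (rule exec.Seq)
  moreover have "n * Suc (time_bound L ?body) \<le> L * Suc (time_bound L ?body)"
    using bnd(2) by (rule mult_le_mono1)
  then have "1 + t \<le> time_bound L (For x bnd c)"
    using r(2) by (simp add: For_def)
  moreover have "Q s'"
    using r(3,4) final by blast
  ultimately show ?thesis
    unfolding wp_def by blast
qed

text \<open>A linear bound \<open>L\<close> on all iteration counts, composed with the polynomial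
  for \<open>time_bound\<close>, is again a polynomial in the input length.\<close>

lemma poly_time_computableI:
  assumes "\<And>x. x \<in> D \<Longrightarrow>
    wp (k * length (enc x) + l) c (\<lambda>s. of_nat (s ''out'' 0) = f x) (input_state (enc x))"
  shows "poly_time_computable enc D f"
proof -
  obtain p where p: "\<And>L. time_bound L c = poly p L"
    using time_bound_poly by blast
  have "time_bound (k * L + l) c = poly (pcompose p [:l, k:]) L" for L
    by (simp add: p poly_pcompose algebra_simps)
  then show ?thesis
    using assms unfolding poly_time_computable_def wp_def by metis
qed

text \<open>Meant for loops that enumerate: the set in \<open>I\<close> collects the contributions
  \<open>f i\<close> seen so far. As the initial set \<open>Q\<close> is arbitrary, an inner loop
  continues with the set of the outer one, and nested loops yield nested unions.\<close>

lemma wp_For_accum: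
  assumes bnd: "aval bnd s\<^sub>0 = n" "n \<le> L" "reads bnd \<inter> insert x (writes c) = {}" "x \<notin> writes c"
    and counter: "\<And>R s f. I R s \<Longrightarrow> I R (s(x := f))"
    and init: "I Q s\<^sub>0"
    and step: "\<And>i s R. i < n \<Longrightarrow> I R s \<Longrightarrow> s x 0 = i \<Longrightarrow>
      (\<And>y. y \<notin> insert x (writes c) \<Longrightarrow> s y = s\<^sub>0 y) \<Longrightarrow> wp L c (I (R \<union> f i)) s"
  shows "wp L (For x bnd c) (I (Q \<union> (\<Union>i<n. f i))) s\<^sub>0"
proof (rule wp_For[where I = "\<lambda>i. I (Q \<union> (\<Union>k<i. f k))", OF bnd])
  show "I (Q \<union> (\<Union>k<0. f k)) (s\<^sub>0(x := (s\<^sub>0 x)(0 := 0)))"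
    using counter init by simp
  fix i s
  assume i: "i < n" "I (Q \<union> (\<Union>k<i. f k)) s" "s x 0 = i"
    "\<And>y. y \<notin> insert x (writes c) \<Longrightarrow> s y = s\<^sub>0 y"
  have "wp L c (I (Q \<union> (\<Union>k<i. f k) \<union> f i)) s"
    by (rule step[OF i])
  then show "wp L c (\<lambda>s'. I (Q \<union> (\<Union>k<Suc i. f k)) (s'(x := (s' x)(0 := Suc i)))) s"
    by (rule wp_frame) (auto intro!: counter simp: lessThan_Suc Un_ac)
qed

section \<open>Edit distance and symmetric difference of edge sets\<close>

text \<open>The common ground of both cost functions. Over \<open>unit\<close> a relabeling never
  changes a label, so the costs \<infinity> and 2 in \<open>C_E\<close> are never charged; in
  \<open>C_E_free_relabeling\<close> they are 0.\<close>

definition counts_edge_edits :: "(('v, 'l) edit_op \<Rightarrow> ennreal) \<Rightarrow> bool" where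
  "counts_edge_edits C \<longleftrightarrow>
     (\<forall>v a. C (VIns v a) = 0) \<and> (\<forall>v. C (VDel v) = 0) \<and> (\<forall>v a b. C (VRel v a b) = 0) \<and>
     (\<forall>e a. C (EIns e a) = 1) \<and> (\<forall>e. C (EDel e) = 1) \<and> (\<forall>e a b. C (ERel e a b) = 0)"

lemma counts_edge_edits_C_E: "counts_edge_edits (C_E :: ('v, unit) edit_op \<Rightarrow> ennreal)"
  by (simp add: counts_edge_edits_def C_E_def)

lemma counts_edge_edits_C_E_free_relabeling: "counts_edge_edits C_E_free_relabeling"
  by (simp add: counts_edge_edits_def C_E_free_relabeling_def)

lemma is_graph_finite_edges: "is_graph G \<Longrightarrow> finite (edges G)"
proof -
  assume "is_graph G"
  then have "edges G \<subseteq> Pow (verts G)" "finite (verts G)"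
    by (auto simp: is_graph_def)
  then show ?thesis
    using finite_subset by blast
qed

text \<open>Here the conditions of restricted edit paths enter: a vertex disappears only when no
  edge is left at it, and an inserted edge finds its endpoints.\<close>

lemma is_graph_apply_op:
  assumes "is_graph G" "applicable G x"
  shows "is_graph (apply_op G x)"
  unfolding is_graph_def
proof (intro conjI ballI)
  show "finite (verts (apply_op G x))"
    using assms by (cases x) (auto simp: is_graph_def)
  fix e assume e: "e \<in> edges (apply_op G x)"
  have "\<exists>u v. u \<in> verts (apply_op G x) \<and> v \<in> verts (apply_op G x) \<and> u \<noteq> v \<and> e = {u, v}"
  proof (cases "e \<in> edges G")
    case True
    then obtain u v where "u \<in> verts G" "v \<in> verts G" "u \<noteq> v" "e = {u, v}"
      using assms unfolding is_graph_def by blast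
    moreover have "w \<in> verts (apply_op G x)" if "w \<in> verts G" "w \<in> e" for w
      using assms(2) True that by (cases x) auto
    ultimately show ?thesis
      by blast
  next
    case False
    then show ?thesis
      using e assms(2) by (cases x) auto
  qed
  then show "\<exists>u\<in>verts (apply_op G x). \<exists>v\<in>verts (apply_op G x). u \<noteq> v \<and> e = {u, v}"
    by blast
qed

lemma is_graph_edited: "is_graph G \<Longrightarrow> all_applicable G \<gamma> \<Longrightarrow> is_graph (foldl apply_op G \<gamma>)"
  by (induction \<gamma> arbitrary: G) (auto simp: is_graph_apply_op)

lemma all_applicable_append:
  "all_applicable G (xs @ ys) \<longleftrightarrow> all_applicable G xs \<and> all_applicable (foldl apply_op G xs) ys"
  by (induction xs arbitrary: G) auto

lemma finite_edges_apply_op: "finite (edges G) \<Longrightarrow> finite (edges (apply_op G x))"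
  by (cases x) auto

lemma finite_edges_edited: "finite (edges G) \<Longrightarrow> finite (edges (foldl apply_op G \<gamma>))"
  by (induction \<gamma> arbitrary: G) (auto simp: finite_edges_apply_op)

lemma card_sym_diff_apply_op_le:
  assumes "counts_edge_edits C"
  shows "of_nat (card (sym_diff (edges G) (edges (apply_op G x)))) \<le> C x"
proof (cases x)
  case (EIns e a)
  then have "sym_diff (edges G) (edges (apply_op G x)) \<subseteq> {e}"
    by auto
  then have "card (sym_diff (edges G) (edges (apply_op G x))) \<le> 1"
    using card_mono[of "{e}"] by simp
  then show ?thesis
    using assms EIns by (simp add: counts_edge_edits_def)
next
  case (EDel e)
  then have "sym_diff (edges G) (edges (apply_op G x)) \<subseteq> {e}"
    by auto
  then have "card (sym_diff (edges G) (edges (apply_op G x))) \<le> 1"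
    using card_mono[of "{e}"] by simp
  then show ?thesis
    using assms EDel by (simp add: counts_edge_edits_def)
qed simp_all

text \<open>Triangle inequality for the symmetric difference: each operation changes the edge set by
  at most its own cost.\<close>

lemma card_sym_diff_le_path_cost:
  assumes "counts_edge_edits C" "finite (edges G)"
  shows "of_nat (card (sym_diff (edges G) (edges (foldl apply_op G \<gamma>)))) \<le> path_cost C \<gamma>"
  using assms(2)
proof (induction \<gamma> arbitrary: G)
  case Nil
  then show ?case by simp
next
  case (Cons x \<gamma>)
  let ?G = "apply_op G x" and ?F = "foldl apply_op G (x # \<gamma>)"
  have fin: "finite (edges ?G)" "finite (edges ?F)"
    using Cons.prems finite_edges_apply_op finite_edges_edited by blast+
  have "sym_diff (edges G) (edges ?F) \<subseteq>
      sym_diff (edges G) (edges ?G) \<union> sym_diff (edges ?G) (edges ?F)"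
    by blast
  then have "card (sym_diff (edges G) (edges ?F)) \<le>
      card (sym_diff (edges G) (edges ?G) \<union> sym_diff (edges ?G) (edges ?F))"
    using Cons.prems fin by (intro card_mono) auto
  also have "\<dots> \<le> card (sym_diff (edges G) (edges ?G)) + card (sym_diff (edges ?G) (edges ?F))"
    by (rule card_Un_le)
  finally have "(of_nat (card (sym_diff (edges G) (edges ?F))) :: ennreal) \<le>
      of_nat (card (sym_diff (edges G) (edges ?G))) + of_nat (card (sym_diff (edges ?G) (edges ?F)))"
    by (simp only: of_nat_add[symmetric] of_nat_le_iff)
  also have "\<dots> \<le> C x + path_cost C \<gamma>"
    using Cons.IH[OF fin(1)] card_sym_diff_apply_op_le[OF assms(1)] by (intro add_mono) auto
  finally show ?case
    by (simp add: path_cost_def)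
qed

section \<open>Edit paths that realize a symmetric difference\<close>

lemma EDel_list:
  assumes "distinct es" "set es \<subseteq> edges G"
  shows "all_applicable G (map EDel es)"
    and "foldl apply_op G (map EDel es) = G\<lparr>edges := edges G - set es\<rparr>"
  using assms
proof (induction es arbitrary: G)
  case (Cons e es)
  {
    case (1 G)
    let ?G = "G\<lparr>edges := edges G - {e}\<rparr>"
    show ?case using 1 by (auto intro!: Cons.IH(1)[of ?G])
  next
    case (2 G)
    let ?G = "G\<lparr>edges := edges G - {e}\<rparr>"
    have "edges G - {e} - set es = edges G - set (e # es)"
      by auto
    moreover have "foldl apply_op ?G (map EDel es) = ?G\<lparr>edges := edges ?G - set es\<rparr>"
      by (rule Cons.IH(2)) (use 2 in auto)
    ultimately show ?case by simp
  }
qed auto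

lemma VDel_list:
  assumes "distinct vs" "set vs \<subseteq> verts G" "\<forall>e \<in> edges G. e \<inter> set vs = {}"
  shows "all_applicable G (map VDel vs)"
    and "foldl apply_op G (map VDel vs) = G\<lparr>verts := verts G - set vs\<rparr>"
  using assms
proof (induction vs arbitrary: G)
  case (Cons v vs)
  {
    case (1 G)
    let ?G = "G\<lparr>verts := verts G - {v}\<rparr>"
    show ?case using 1 by (auto intro!: Cons.IH(1)[of ?G])
  next
    case (2 G)
    let ?G = "G\<lparr>verts := verts G - {v}\<rparr>"
    have "verts G - {v} - set vs = verts G - set (v # vs)"
      by auto
    moreover have "foldl apply_op ?G (map VDel vs) = ?G\<lparr>verts := verts ?G - set vs\<rparr>"
      by (rule Cons.IH(2)) (use 2 in auto)
    ultimately show ?case by simp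
  }
qed auto

lemma VIns_list:
  assumes "distinct vs" "set vs \<inter> verts G = {}"
  shows "all_applicable G (map (\<lambda>v. VIns v (f v)) vs)"
    and "foldl apply_op G (map (\<lambda>v. VIns v (f v)) vs) =
      G\<lparr>verts := verts G \<union> set vs, vlab := override_on (vlab G) f (set vs)\<rparr>"
  using assms
proof (induction vs arbitrary: G)
  case (Cons v vs)
  {
    case (1 G)
    let ?G = "G\<lparr>verts := insert v (verts G), vlab := (vlab G)(v := f v)\<rparr>"
    show ?case using 1 by (auto intro!: Cons.IH(1)[of ?G])
  next
    case (2 G)
    let ?G = "G\<lparr>verts := insert v (verts G), vlab := (vlab G)(v := f v)\<rparr>"
    have "foldl apply_op ?G (map (\<lambda>v. VIns v (f v)) vs) =
      ?G\<lparr>verts := verts ?G \<union> set vs, vlab := override_on (vlab ?G) f (set vs)\<rparr>"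
      by (rule Cons.IH(2)) (use 2 in auto)
    then show ?case
      using 2 by (simp add: override_on_insert')
  }
qed auto

lemma EIns_list:
  assumes "distinct es" "set es \<inter> edges G = {}"
    and "\<forall>e \<in> set es. \<exists>u \<in> verts G. \<exists>v \<in> verts G. u \<noteq> v \<and> e = {u, v}"
  shows "all_applicable G (map (\<lambda>e. EIns e (f e)) es)"
    and "foldl apply_op G (map (\<lambda>e. EIns e (f e)) es) =
      G\<lparr>edges := edges G \<union> set es, elab := override_on (elab G) f (set es)\<rparr>"
  using assms
proof (induction es arbitrary: G)
  case (Cons e es)
  {
    case (1 G)
    let ?G = "G\<lparr>edges := insert e (edges G), elab := (elab G)(e := f e)\<rparr>"
    have "all_applicable ?G (map (\<lambda>e. EIns e (f e)) es)"
      by (rule Cons.IH(1)) (use 1 in \<open>simp_all add: disjoint_iff\<close>)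
    then show ?case
      using 1 by simp
  next
    case (2 G)
    let ?G = "G\<lparr>edges := insert e (edges G), elab := (elab G)(e := f e)\<rparr>"
    have "foldl apply_op ?G (map (\<lambda>e. EIns e (f e)) es) =
      ?G\<lparr>edges := edges ?G \<union> set es, elab := override_on (elab ?G) f (set es)\<rparr>"
      by (rule Cons.IH(2)) (use 2 in \<open>simp_all add: disjoint_iff\<close>)
    then show ?case
      using 2 by (simp add: override_on_insert')
  }
qed auto

lemma VRel_list:
  assumes "distinct vs" "set vs \<subseteq> verts G" "\<And>v. v \<in> set vs \<Longrightarrow> vlab G v = g v"
  shows "all_applicable G (map (\<lambda>v. VRel v (g v) (f v)) vs)"
    and "foldl apply_op G (map (\<lambda>v. VRel v (g v) (f v)) vs) =
      G\<lparr>vlab := override_on (vlab G) f (set vs)\<rparr>"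
  using assms
proof (induction vs arbitrary: G)
  case (Cons v vs)
  {
    case (1 G)
    let ?G = "G\<lparr>vlab := (vlab G)(v := f v)\<rparr>"
    show ?case using 1 by (auto intro!: Cons.IH(1)[of ?G])
  next
    case (2 G)
    let ?G = "G\<lparr>vlab := (vlab G)(v := f v)\<rparr>"
    have "foldl apply_op ?G (map (\<lambda>v. VRel v (g v) (f v)) vs) =
      ?G\<lparr>vlab := override_on (vlab ?G) f (set vs)\<rparr>"
      by (rule Cons.IH(2)) (use 2 in auto)
    then show ?case
      using 2 by (simp add: override_on_insert')
  }
qed auto

lemma ERel_list:
  assumes "distinct es" "set es \<subseteq> edges G" "\<And>e. e \<in> set es \<Longrightarrow> elab G e = g e"
  shows "all_applicable G (map (\<lambda>e. ERel e (g e) (f e)) es)"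
    and "foldl apply_op G (map (\<lambda>e. ERel e (g e) (f e)) es) =
      G\<lparr>elab := override_on (elab G) f (set es)\<rparr>"
  using assms
proof (induction es arbitrary: G)
  case (Cons e es)
  {
    case (1 G)
    let ?G = "G\<lparr>elab := (elab G)(e := f e)\<rparr>"
    show ?case using 1 by (auto intro!: Cons.IH(1)[of ?G])
  next
    case (2 G)
    let ?G = "G\<lparr>elab := (elab G)(e := f e)\<rparr>"
    have "foldl apply_op ?G (map (\<lambda>e. ERel e (g e) (f e)) es) =
      ?G\<lparr>elab := override_on (elab ?G) f (set es)\<rparr>"
      by (rule Cons.IH(2)) (use 2 in auto)
    then show ?case
      using 2 by (simp add: override_on_insert')
  }
qed auto

text \<open>Everything outside \<open>F\<close> is deleted, edges before vertices; everything
  missing is inserted, vertices before edges; what both graphs share is relabeled, at no cost. Only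
  the edges of the symmetric difference are charged.\<close>

lemma GED_le_card_sym_diff:
  assumes C: "counts_edge_edits C" and G: "is_graph G" and F: "is_graph F" and iso: "isomorphic F H"
  shows "GED G H C \<le> of_nat (card (sym_diff (edges G) (edges F)))"
proof -
  have fin: "finite (verts G)" "finite (verts F)" "finite (edges G)" "finite (edges F)"
    using G F is_graph_finite_edges by (auto simp: is_graph_def)
  obtain de where de: "set de = edges G - edges F" "distinct de"
    using finite_distinct_list[of "edges G - edges F"] fin by auto
  obtain dv where dv: "set dv = verts G - verts F" "distinct dv"
    using finite_distinct_list[of "verts G - verts F"] fin by auto
  obtain iv where iv: "set iv = verts F - verts G" "distinct iv"
    using finite_distinct_list[of "verts F - verts G"] fin by auto
  obtain ie where ie: "set ie = edges F - edges G" "distinct ie"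
    using finite_distinct_list[of "edges F - edges G"] fin by auto
  obtain rv where rv: "set rv = verts F \<inter> verts G" "distinct rv"
    using finite_distinct_list[of "verts F \<inter> verts G"] fin by auto
  obtain re where re: "set re = edges F \<inter> edges G" "distinct re"
    using finite_distinct_list[of "edges F \<inter> edges G"] fin by auto
  define a1 :: "('a, 'b) edit_op list" where "a1 = map EDel de"
  define a2 :: "('a, 'b) edit_op list" where "a2 = map VDel dv"
  define a3 where "a3 = map (\<lambda>v. VIns v (vlab F v)) iv"
  define a4 where "a4 = map (\<lambda>e. EIns e (elab F e)) ie"
  define a5 where "a5 = map (\<lambda>v. VRel v (vlab G v) (vlab F v)) rv"
  define a6 where "a6 = map (\<lambda>e. ERel e (elab G e) (elab F e)) re"
  define G1 where "G1 = G\<lparr>edges := edges G \<inter> edges F\<rparr>"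
  define G2 where "G2 = G1\<lparr>verts := verts G \<inter> verts F\<rparr>"
  define G3 where "G3 = G2\<lparr>verts := verts F, vlab := override_on (vlab G) (vlab F) (set iv)\<rparr>"
  define G4 where "G4 = G3\<lparr>edges := edges F, elab := override_on (elab G) (elab F) (set ie)\<rparr>"
  define G5 where "G5 = G4\<lparr>vlab := override_on (vlab G4) (vlab F) (set rv)\<rparr>"
  define G6 where "G6 = G5\<lparr>elab := override_on (elab G5) (elab F) (set re)\<rparr>"
  note defs = G1_def G2_def G3_def G4_def G5_def G6_def
  have F_edge: "\<exists>u \<in> verts F. \<exists>v \<in> verts F. u \<noteq> v \<and> e = {u, v}" if "e \<in> edges F" for e
    using F that by (simp add: is_graph_def)
  have 1: "all_applicable G a1" "foldl apply_op G a1 = G1"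
    using EDel_list[of de G] de by (auto simp: a1_def G1_def Diff_Diff_Int)
  \<comment> \<open>The remaining edges belong to \<open>F\<close>, so their endpoints are vertices
    of \<open>F\<close> and no edge blocks a deletion.\<close>
  have "e \<inter> set dv = {}" if "e \<in> edges G1" for e
    using F_edge[of e] that dv by (auto simp: G1_def)
  then have 2: "all_applicable G1 a2" "foldl apply_op G1 a2 = G2"
    using VDel_list[of dv G1] dv by (auto simp: a2_def G2_def G1_def Diff_Diff_Int)
  have "verts G \<inter> verts F \<union> (verts F - verts G) = verts F"
    by blast
  then have 3: "all_applicable G2 a3" "foldl apply_op G2 a3 = G3"
    using VIns_list[of iv G2 "vlab F"] iv by (auto simp: a3_def G3_def G2_def G1_def)
  have "edges G \<inter> edges F \<union> (edges F - edges G) = edges F"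
    by blast
  then have 4: "all_applicable G3 a4" "foldl apply_op G3 a4 = G4"
    using EIns_list[of ie G3 "elab F"] ie F_edge by (auto simp: a4_def G4_def G3_def G2_def G1_def)
  have 5: "all_applicable G4 a5" "foldl apply_op G4 a5 = G5"
    using VRel_list[of rv G4 "vlab G" "vlab F"] rv iv
    by (auto simp: a5_def G5_def G4_def G3_def G2_def G1_def override_on_def)
  have 6: "all_applicable G5 a6" "foldl apply_op G5 a6 = G6"
    using ERel_list[of re G5 "elab G" "elab F"] re ie
    by (auto simp: a6_def G6_def G5_def G4_def G3_def G2_def G1_def override_on_def)
  define \<gamma> where "\<gamma> = a1 @ a2 @ a3 @ a4 @ a5 @ a6"
  have "all_applicable G \<gamma>" and res: "foldl apply_op G \<gamma> = G6"
    using 1 2 3 4 5 6 by (simp_all add: \<gamma>_def all_applicable_append)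
  \<comment> \<open>Deleted, inserted and shared items are disjoint among the vertices and among the
    edges, and \<open>Inl\<close> and \<open>Inr\<close> separate the two kinds.\<close>
  moreover have "distinct (map edited \<gamma>)"
    using de dv iv ie rv re
    by (auto simp: \<gamma>_def a1_def a2_def a3_def a4_def a5_def a6_def distinct_map inj_on_def)
  moreover have "isomorphic G6 H"
  proof -
    have 1: "verts G6 = verts F" "edges G6 = edges F"
      by (simp_all add: defs)
    have 2: "vlab G6 v = vlab F v" if "v \<in> verts F" for v
      using that iv rv by (simp add: defs override_on_def)
    have 3: "elab G6 e = elab F e" if "e \<in> edges F" for e
      using that ie re by (simp add: defs override_on_def)
    show ?thesis
      using iso 2 3 unfolding isomorphic_def 1 by metis
  qed
  ultimately have "restricted_edit_path G H \<gamma>"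
    by (simp add: restricted_edit_path_def)
  then have "GED G H C \<le> path_cost C \<gamma>"
    unfolding GED_def by (intro INF_lower) simp
  also have "path_cost C \<gamma> = of_nat (length de) + of_nat (length ie)"
    using C by (simp add: path_cost_def \<gamma>_def a1_def a2_def a3_def a4_def a5_def a6_def o_def
        counts_edge_edits_def sum_list_triv)
  also have "\<dots> = of_nat (length de + length ie)"
    by simp
  also have "length de + length ie = card (sym_diff (edges G) (edges F))"
    using fin de ie by (subst card_Un_disjoint) (auto simp flip: distinct_card)
  finally show ?thesis .
qed

text \<open>The final graph of any restricted edit path is itself an admissible \<open>F\<close>,
  and the path costs at least the symmetric difference with it.\<close>

lemma GED_ge:
  assumes C: "counts_edge_edits C" and G: "is_graph G"
    and le: "\<And>F. is_graph F \<Longrightarrow> isomorphic F H \<Longrightarrow> k \<le> card (sym_diff (edges G) (edges F))"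
  shows "of_nat k \<le> GED G H C"
  unfolding GED_def
proof (rule INF_greatest)
  fix \<gamma> assume "\<gamma> \<in> {\<gamma>. restricted_edit_path G H \<gamma>}"
  then have "is_graph (foldl apply_op G \<gamma>)" "isomorphic (foldl apply_op G \<gamma>) H"
    using is_graph_edited[OF G] by (auto simp: restricted_edit_path_def)
  then have "(of_nat k :: ennreal) \<le> of_nat (card (sym_diff (edges G) (edges (foldl apply_op G \<gamma>))))"
    using le by simp
  also have "\<dots> \<le> path_cost C \<gamma>"
    by (rule card_sym_diff_le_path_cost[OF C is_graph_finite_edges[OF G]])
  finally show "of_nat k \<le> path_cost C \<gamma>" .
qed

section \<open>Linear forests in a tree\<close>

text \<open>
  A tree is given by a parent function with \<open>par k < k\<close> for \<open>0 < k < m\<close>. A set \<open>X \<subseteq> {1..<m}\<close>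
  represents the set of the edges \<open>{k, par k}\<close> with \<open>k \<in> X\<close>.
\<close>

definition edge_degree :: "(nat \<Rightarrow> nat) \<Rightarrow> nat set \<Rightarrow> nat \<Rightarrow> nat" where
  "edge_degree par X v = card {k \<in> X. k = v \<or> par k = v}"

definition supp :: "(nat \<Rightarrow> nat) \<Rightarrow> nat set \<Rightarrow> nat set" where
  "supp par X = X \<union> par ` X"

text \<open>The degree bound alone describes disjoint unions of paths, because edges to smaller
  parents form no cycle.\<close>

definition linear_forest :: "(nat \<Rightarrow> nat) \<Rightarrow> nat set \<Rightarrow> bool" where
  "linear_forest par X \<longleftrightarrow> (\<forall>v. edge_degree par X v \<le> 2)"

lemma edge_degree_empty [simp]: "edge_degree par {} v = 0"
  by (simp add: edge_degree_def)

lemma supp_empty [simp]: "supp par {} = {}"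
  by (simp add: supp_def)

lemma finite_supp [simp]: "finite X \<Longrightarrow> finite (supp par X)"
  by (simp add: supp_def)

lemma linear_forest_empty [simp]: "linear_forest par {}"
  by (simp add: linear_forest_def)

lemma edge_degree_insert:
  assumes "finite X" "i \<notin> X"
  shows "edge_degree par (insert i X) v = edge_degree par X v + (if v = i \<or> v = par i then 1 else 0)"
proof -
  have "{k \<in> insert i X. k = v \<or> par k = v} =
      (if v = i \<or> v = par i then insert i {k \<in> X. k = v \<or> par k = v} else {k \<in> X. k = v \<or> par k = v})"
    by auto
  then show ?thesis
    using assms by (simp add: edge_degree_def)
qed

lemma supp_insert: "supp par (insert i X) = insert i (insert (par i) (supp par X))"
  by (auto simp: supp_def)

text \<open>This lets the degree of a root decide whether a further edge covers a new
  vertex.\<close>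

lemma edge_degree_pos_iff: "finite X \<Longrightarrow> 0 < edge_degree par X v \<longleftrightarrow> v \<in> supp par X"
  by (auto simp: edge_degree_def supp_def card_gt_0_iff)

lemma linear_forest_subset:
  assumes "linear_forest par X" "Y \<subseteq> X" "finite X"
  shows "linear_forest par Y"
  unfolding linear_forest_def
proof
  fix v
  have "edge_degree par Y v \<le> edge_degree par X v"
    unfolding edge_degree_def using assms by (intro card_mono) auto
  then show "edge_degree par Y v \<le> 2"
    using assms(1) unfolding linear_forest_def by (meson le_trans)
qed

section \<open>Layout of a linear forest along a list\<close>

fun consecutive :: "'a list \<Rightarrow> 'a set set" where
  "consecutive (x # y # xs) = insert {x, y} (consecutive (y # xs))"
| "consecutive _ = {}"

lemma consecutive_Cons:
  "consecutive (x # xs) = (if xs = [] then {} else insert {x, hd xs} (consecutive xs))"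
  by (cases xs) auto

lemma consecutive_append:
  "consecutive (xs @ ys) =
     consecutive xs \<union> consecutive ys \<union> (if xs = [] \<or> ys = [] then {} else {{last xs, hd ys}})"
  by (induction xs) (auto simp: consecutive_Cons)

lemma consecutive_nth: "consecutive xs = {{xs ! i, xs ! Suc i} | i. Suc i < length xs}"
proof (induction xs rule: consecutive.induct)
  case (1 x y xs)
  have "{{(x # y # xs) ! i, (x # y # xs) ! Suc i} | i. Suc i < length (x # y # xs)} =
      insert {x, y} {{(y # xs) ! i, (y # xs) ! Suc i} | i. Suc i < length (y # xs)}" (is "?L = ?R")
  proof
    show "?L \<subseteq> ?R"
    proof
      fix e assume "e \<in> ?L"
      then obtain i where "Suc i < length (x # y # xs)" "e = {(x # y # xs) ! i, (x # y # xs) ! Suc i}"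
        by blast
      then show "e \<in> ?R"
        by (cases i) auto
    qed
    show "?R \<subseteq> ?L"
    proof
      fix e assume "e \<in> ?R"
      then consider "e = {x, y}" | i where "Suc i < length (y # xs)" "e = {(y # xs) ! i, (y # xs) ! Suc i}"
        by blast
      then show "e \<in> ?L"
      proof cases
        case 1
        then show ?thesis
          by (intro CollectI exI[of _ 0]) simp
      next
        case 2
        then show ?thesis
          by (intro CollectI exI[of _ "Suc i"]) simp
      qed
    qed
  qed
  then show ?case
    using 1 by simp
qed auto

text \<open>
  The largest element of \<open>X\<close> is a leaf, so it can be put next to its parent, on a side
  where the parent has no neighbor yet.
\<close>

lemma linear_forest_layout:
  assumes "finite X" "linear_forest par X" "\<And>k. k \<in> X \<Longrightarrow> par k < k"
  shows "\<exists>ws. distinct ws \<and> set ws = supp par X \<and> (\<forall>k \<in> X. {k, par k} \<in> consecutive ws)"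
  using assms
proof (induction X rule: finite_linorder_max_induct)
  case empty
  show ?case
    by (intro exI[of _ "[]"]) simp
next
  case (insert k X)
  let ?p = "par k"
  have kX: "k \<notin> X"
    using insert.hyps(2) by auto
  have "linear_forest par X"
    using insert.prems(1) insert.hyps(1) by (auto intro: linear_forest_subset)
  then obtain ws where ws: "distinct ws" "set ws = supp par X"
    "\<And>l. l \<in> X \<Longrightarrow> {l, par l} \<in> consecutive ws"
    using insert.IH insert.prems(2) by blast
  have p: "?p < k"
    using insert.prems(2) by blast
  \<comment> \<open>The elements of \<open>X\<close> are below \<open>k\<close>, and their parents
    are smaller still.\<close>
  have k: "k \<notin> set ws"
    using insert.hyps(2) insert.prems(2) unfolding ws(2) supp_def
    by (metis UnE image_iff insertI2 less_asym less_irrefl)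
  show ?case
  proof (cases "?p \<in> set ws")
    case False
    \<comment> \<open>The new edge becomes a piece of its own at the end. That
      \<open>last ws\<close> and \<open>?p\<close> become neighbors is harmless: consecutive entries
      need not form an edge.\<close>
    have "distinct (ws @ [?p, k])" "set (ws @ [?p, k]) = supp par (insert k X)"
      using ws k False p by (auto simp: supp_insert)
    moreover have "{l, par l} \<in> consecutive (ws @ [?p, k])" if "l \<in> insert k X" for l
      using that ws(3)[of l] by (cases "l = k") (auto simp: consecutive_append)
    ultimately show ?thesis
      by blast
  next
    case True
    then obtain xs ys where xy: "ws = xs @ ?p # ys"
      by (meson split_list)
    \<comment> \<open>The edge of \<open>k\<close> takes up one of the two possible edges at the
      parent.\<close>
    have deg: "edge_degree par X ?p \<le> 1"
      using insert.prems(1) edge_degree_insert[OF insert.hyps(1) kX, of par ?p]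
      unfolding linear_forest_def by (metis add_le_cancel_right one_add_one)
    have cons_ws: "consecutive ws = consecutive xs \<union> consecutive ys \<union>
        (if xs = [] then {} else {{last xs, ?p}}) \<union> (if ys = [] then {} else {{?p, hd ys}})"
      by (auto simp: xy consecutive_append consecutive_Cons)
    have mem: "e \<in> A \<union> B \<union> (if c then {} else {a}) \<union> (if d then {} else {b}) \<longleftrightarrow>
        e \<in> A \<or> e \<in> B \<or> \<not> c \<and> e = a \<or> \<not> d \<and> e = b" for e a b :: "nat set" and A B c d
      by simp
    let ?E = "(\<lambda>l. {l, par l}) ` X"
    \<comment> \<open>Otherwise both neighbors of \<open>?p\<close> in the list would belong to
      edges of \<open>X\<close>, giving degree 2.\<close>
    have "xs = [] \<or> ys = [] \<or> {last xs, ?p} \<notin> ?E \<or> {?p, hd ys} \<notin> ?E"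
    proof (rule ccontr)
      assume "\<not> ?thesis"
      then obtain a b where ab: "xs \<noteq> []" "ys \<noteq> []" "a \<in> X" "b \<in> X"
        "{last xs, ?p} = {a, par a}" "{?p, hd ys} = {b, par b}"
        by auto
      have "last xs \<in> set xs" "hd ys \<in> set ys"
        using ab by auto
      then have "last xs \<noteq> hd ys"
        using ws(1) xy by auto
      then have "a \<noteq> b"
        using ab(5,6) by (auto simp: doubleton_eq_iff)
      moreover have "{a, b} \<subseteq> {l \<in> X. l = ?p \<or> par l = ?p}"
        using ab by (auto simp: doubleton_eq_iff)
      then have "card {a, b} \<le> edge_degree par X ?p"
        unfolding edge_degree_def using insert.hyps(1) by (intro card_mono) auto
      ultimately show False
        using deg by simp
    qed
    then consider "ys = [] \<or> {?p, hd ys} \<notin> ?E" | "xs = [] \<or> {last xs, ?p} \<notin> ?E"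
      by blast
    then show ?thesis
    proof cases
      case 1
      \<comment> \<open>Only the pair \<open>{?p, hd ys}\<close> ceases to be consecutive, and no
        edge of \<open>X\<close> relies on it.\<close>
      let ?ws = "xs @ ?p # k # ys"
      have "distinct ?ws" "set ?ws = supp par (insert k X)"
        using ws k p xy by (auto simp: supp_insert)
      moreover have "{l, par l} \<in> consecutive ?ws" if "l \<in> insert k X" for l
      proof (cases "l = k")
        case True
        then show ?thesis
          by (auto simp: consecutive_append insert_commute)
      next
        case False
        define e where "e = {l, par l}"
        have "e \<in> ?E" "e \<in> consecutive ws"
          using that ws(3) False by (auto simp: e_def)
        then have "e \<in> consecutive xs \<or> e \<in> consecutive ys \<or> xs \<noteq> [] \<and> e = {last xs, ?p}"
          using 1 unfolding cons_ws mem by metis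
        then have "e \<in> consecutive ?ws"
          by (elim disjE; cases "ys = []"; cases "xs = []"; simp add: consecutive_append consecutive_Cons)
        then show ?thesis
          by (simp add: e_def)
      qed
      ultimately show ?thesis
        by blast
    next
      case 2
      let ?ws = "xs @ k # ?p # ys"
      have "distinct ?ws" "set ?ws = supp par (insert k X)"
        using ws k p xy by (auto simp: supp_insert)
      moreover have "{l, par l} \<in> consecutive ?ws" if "l \<in> insert k X" for l
      proof (cases "l = k")
        case True
        then show ?thesis
          by (auto simp: consecutive_append)
      next
        case False
        define e where "e = {l, par l}"
        have "e \<in> ?E" "e \<in> consecutive ws"
          using that ws(3) False by (auto simp: e_def)
        then have "e \<in> consecutive xs \<or> e \<in> consecutive ys \<or> ys \<noteq> [] \<and> e = {?p, hd ys}"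
          using 2 unfolding cons_ws mem by metis
        then have "e \<in> consecutive ?ws"
          by (elim disjE; cases "ys = []"; cases "xs = []"; simp add: consecutive_append consecutive_Cons)
        then show ?thesis
          by (simp add: e_def)
      qed
      ultimately show ?thesis
        by blast
    qed
  qed
qed

section \<open>Copies of the tree and their overlap with the path\<close>

text \<open>With the search order as \<open>g\<close> this is the edge set of the tree itself; any
  other injective \<open>g\<close> gives a copy.\<close>

definition parent_edges :: "(nat \<Rightarrow> 'a) \<Rightarrow> (nat \<Rightarrow> nat) \<Rightarrow> nat \<Rightarrow> 'a set set" where
  "parent_edges g par m = (\<lambda>k. {g k, g (par k)}) ` {1..<m}"

text \<open>The child is the larger endpoint, so an edge determines its index.\<close>

lemma inj_on_parent_edge:
  fixes g :: "nat \<Rightarrow> 'a"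
  assumes "inj_on g {..<m}" "\<And>k. 0 < k \<Longrightarrow> k < m \<Longrightarrow> par k < k"
  shows "inj_on (\<lambda>k. {g k, g (par k)}) {1..<m}"
proof (rule inj_onI)
  fix k l assume kl: "k \<in> {1..<m}" "l \<in> {1..<m}" "{g k, g (par k)} = {g l, g (par l)}"
  have less: "k < m" "l < m" "par k < k" "par l < l"
    using kl(1,2) assms(2) by (simp_all add: Suc_le_eq)
  then have "{k, par k} = {l, par l}"
    using inj_on_image_eq_iff[OF assms(1), of "{k, par k}" "{l, par l}"] kl(3) by simp
  then show "k = l"
    using less by (auto simp: doubleton_eq_iff)
qed

lemma card_edges_at_le_2:
  assumes "distinct vs"
  shows "card {e \<in> consecutive vs. x \<in> e} \<le> 2"
proof (cases "x \<in> set vs")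
  case True
  then obtain a where a: "a < length vs" "x = vs ! a"
    by (auto simp: in_set_conv_nth)
  \<comment> \<open>At the ends of the list one of the two sets is not an edge; a superset is enough
    for the bound.\<close>
  have "{e \<in> consecutive vs. x \<in> e} \<subseteq> {{vs ! a, vs ! Suc a}, {vs ! (a - 1), vs ! a}}"
  proof
    fix e assume "e \<in> {e \<in> consecutive vs. x \<in> e}"
    then obtain i where i: "Suc i < length vs" "e = {vs ! i, vs ! Suc i}" "x \<in> e"
      by (auto simp: consecutive_nth)
    then have "i = a \<or> Suc i = a"
      using a assms by (auto simp: nth_eq_iff_index_eq)
    then show "e \<in> {{vs ! a, vs ! Suc a}, {vs ! (a - 1), vs ! a}}"
      using i by auto
  qed
  then have "card {e \<in> consecutive vs. x \<in> e} \<le> card {{vs ! a, vs ! Suc a}, {vs ! (a - 1), vs ! a}}"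
    by (intro card_mono) auto
  also have "\<dots> \<le> 2"
    by (simp add: card_insert_if)
  finally show ?thesis .
next
  case False
  then have empty: "{e \<in> consecutive vs. x \<in> e} = {}"
    by (auto simp: consecutive_nth)
  show ?thesis
    unfolding empty by simp
qed

lemma finite_consecutive [simp]: "finite (consecutive vs)"
  by (induction vs rule: consecutive.induct) auto

lemma card_consecutive: "distinct vs \<Longrightarrow> card (consecutive vs) = length vs - 1"
proof (induction vs rule: consecutive.induct)
  case (1 x y xs)
  have "{x, y} \<notin> consecutive (y # xs)"
    using 1(2) by (force simp: consecutive_nth doubleton_eq_iff in_set_conv_nth)
  then show ?case
    using 1 by simp
qed auto

text \<open>In additive form, since subtraction on \<open>nat\<close> truncates.\<close>

lemma card_sym_diff:
  assumes "finite A" "finite B"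
  shows "card (sym_diff A B) + 2 * card (A \<inter> B) = card A + card B"
proof -
  have "card A = card (A - B) + card (A \<inter> B)" "card B = card (B - A) + card (A \<inter> B)"
    using assms by (metis add.commute card_Int_Diff Int_commute)+
  moreover have "card (sym_diff A B) = card (A - B) + card (B - A)"
    using assms by (intro card_Un_disjoint) auto
  ultimately show ?thesis
    by simp
qed

text \<open>\<open>g\<close> is the numbering \<open>ord\<close> pulled back along the isomorphism
  from \<open>F\<close> to \<open>H\<close>.\<close>

lemma isomorphic_parent_edges:
  assumes F: "is_graph F" and iso: "isomorphic F H"
    and ord: "bij_betw ord {..<m} (verts H)" "edges H = parent_edges ord par m"
    and par: "\<And>k. 0 < k \<Longrightarrow> k < m \<Longrightarrow> par k < k"
  obtains g where "inj_on g {..<m}" "edges F = parent_edges g par m"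
proof -
  obtain f where f: "bij_betw f (verts F) (verts H)"
    "\<And>u v. u \<in> verts F \<Longrightarrow> v \<in> verts F \<Longrightarrow> {u, v} \<in> edges F \<longleftrightarrow> {f u, f v} \<in> edges H"
    using iso unfolding isomorphic_def by blast
  define g where "g = the_inv_into (verts F) f \<circ> ord"
  have g: "bij_betw g {..<m} (verts F)"
    unfolding g_def using ord(1) f(1) by (intro bij_betw_trans bij_betw_the_inv_into)
  have fg: "f (g k) = ord k" if "k < m" for k
    unfolding g_def using that f(1) ord(1)
    by (simp add: bij_betw_def f_the_inv_into_f) (metis f_the_inv_into_f image_eqI lessThan_iff)
  have inF: "g k \<in> verts F" if "k < m" for k
    using that g by (auto simp: bij_betw_def)
  have parm: "par k < m" if "k \<in> {1..<m}" for k
    using that par[of k] by auto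
  have "edges F = parent_edges g par m"
  proof
    show "edges F \<subseteq> parent_edges g par m"
    proof
      fix e assume e: "e \<in> edges F"
      then obtain u v where uv: "u \<in> verts F" "v \<in> verts F" "e = {u, v}"
        using F unfolding is_graph_def by blast
      obtain a b where ab: "a < m" "b < m" "u = g a" "v = g b"
        using uv g unfolding bij_betw_def by blast
      have "{ord a, ord b} \<in> parent_edges ord par m"
        using f(2)[OF uv(1,2)] e uv ab fg ord(2) by simp
      then obtain k where k: "k \<in> {1..<m}" "{ord a, ord b} = {ord k, ord (par k)}"
        by (auto simp: parent_edges_def)
      have "{a, b} = {k, par k}"
        using inj_on_image_eq_iff[of ord "{..<m}" "{a, b}" "{k, par k}"] ord(1) k ab parm[OF k(1)]
        by (auto simp: bij_betw_def)
      then have "e = {g k, g (par k)}"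
        using uv(3) ab by (auto simp: doubleton_eq_iff)
      then show "e \<in> parent_edges g par m"
        using k(1) by (auto simp: parent_edges_def)
    qed
    show "parent_edges g par m \<subseteq> edges F"
    proof
      fix e assume "e \<in> parent_edges g par m"
      then obtain k where k: "k \<in> {1..<m}" "e = {g k, g (par k)}"
        by (auto simp: parent_edges_def)
      have "{f (g k), f (g (par k))} \<in> edges H"
        using k fg parm[OF k(1)] unfolding ord(2) parent_edges_def by auto
      then show "e \<in> edges F"
        using f(2) inF parm[OF k(1)] k by auto
    qed
  qed
  then show ?thesis
    using that g unfolding bij_betw_def by blast
qed

text \<open>Conversely, every injective placement of the tree vertices is a copy: the labels of
  \<open>F\<close> are taken from \<open>H\<close> along \<open>f\<close>, so \<open>f\<close>
  respects them.\<close>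

lemma parent_edges_isomorphic:
  fixes g :: "nat \<Rightarrow> 'v" and H :: "('w, 'l) lgraph"
  assumes g: "inj_on g {..<m}"
    and ord: "bij_betw ord {..<m} (verts H)" "edges H = parent_edges ord par m"
    and par: "\<And>k. 0 < k \<Longrightarrow> k < m \<Longrightarrow> par k < k"
  obtains F :: "('v, 'l) lgraph" where
    "is_graph F" "isomorphic F H" "edges F = parent_edges g par m"
proof -
  define f where "f = ord \<circ> the_inv_into {..<m} g"
  define F where "F = \<lparr>verts = g ` {..<m}, edges = parent_edges g par m,
    vlab = vlab H \<circ> f, elab = (\<lambda>e. elab H (f ` e))\<rparr>"
  have parm: "par k < m" if "k \<in> {1..<m}" for k
    using that par[of k] by auto
  have fg: "f (g k) = ord k" if "k < m" for k
    using that g by (simp add: f_def the_inv_into_f_f)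
  have f: "bij_betw f (verts F) (verts H)"
    unfolding f_def F_def using g ord(1)
    by (auto intro!: bij_betw_trans[of _ _ "{..<m}"] bij_betw_the_inv_into inj_on_imp_bij_betw)
  have g_eq: "{g a, g b} = {g k, g l} \<longleftrightarrow> {a, b} = {k, l}" if "a < m" "b < m" "k < m" "l < m" for a b k l
    using inj_on_image_eq_iff[OF g, of "{a, b}" "{k, l}"] that by auto
  have ord_eq: "{ord a, ord b} = {ord k, ord l} \<longleftrightarrow> {a, b} = {k, l}" if "a < m" "b < m" "k < m" "l < m" for a b k l
    using inj_on_image_eq_iff[of ord "{..<m}" "{a, b}" "{k, l}"] ord(1) that by (auto simp: bij_betw_def)
  have "{u, v} \<in> edges F \<longleftrightarrow> {f u, f v} \<in> edges H" if "u \<in> verts F" "v \<in> verts F" for u v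
  proof -
    obtain a b where ab: "a < m" "b < m" "u = g a" "v = g b"
      using \<open>u \<in> verts F\<close> \<open>v \<in> verts F\<close> by (auto simp: F_def)
    have "{u, v} \<in> edges F \<longleftrightarrow> (\<exists>k \<in> {1..<m}. {g a, g b} = {g k, g (par k)})"
      by (simp add: ab F_def parent_edges_def image_iff)
    also have "\<dots> \<longleftrightarrow> (\<exists>k \<in> {1..<m}. {ord a, ord b} = {ord k, ord (par k)})"
      using ab(1,2) parm by (intro bex_cong refl) (simp add: g_eq ord_eq)
    also have "\<dots> \<longleftrightarrow> {f u, f v} \<in> edges H"
      using ab by (simp add: fg ord(2) parent_edges_def image_iff cong: bex_cong)
    finally show ?thesis .
  qed
  then have "isomorphic F H"
    unfolding isomorphic_def using f by (intro exI[of _ f]) (simp add: F_def)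
  moreover have "is_graph F"
    unfolding is_graph_def
  proof (intro conjI ballI)
    fix e assume "e \<in> edges F"
    then obtain k where k: "k \<in> {1..<m}" "e = {g k, g (par k)}"
      by (auto simp: F_def parent_edges_def)
    moreover have "g k \<noteq> g (par k)"
      using k(1) par[of k] parm[OF k(1)] inj_on_eq_iff[OF g, of k "par k"] by auto
    ultimately show "\<exists>u\<in>verts F. \<exists>v\<in>verts F. u \<noteq> v \<and> e = {u, v}"
      using parm[OF k(1)] by (intro bexI[of _ "g k"] bexI[of _ "g (par k)"]) (auto simp: F_def)
  qed (simp add: F_def)
  ultimately show ?thesis
    using that by (simp add: F_def)
qed

text \<open>\<open>g\<close> maps the edges of \<open>X\<close> at \<open>v\<close> injectively to
  edges of the path at \<open>g v\<close>, of which there are at most two, and it maps the covered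
  vertices injectively into the path.\<close>

lemma linear_forest_common_edges:
  assumes "distinct vs" "inj_on g {..<m}" and par: "\<And>k. 0 < k \<Longrightarrow> k < m \<Longrightarrow> par k < k"
  defines "X \<equiv> {k \<in> {1..<m}. {g k, g (par k)} \<in> consecutive vs}"
  shows "linear_forest par X" "card (supp par X) \<le> length vs"
    "card (consecutive vs \<inter> parent_edges g par m) = card X"
proof -
  have inj: "inj_on (\<lambda>k. {g k, g (par k)}) X"
    using inj_on_parent_edge[OF assms(2) par] by (rule inj_on_subset) (auto simp: X_def)
  show "linear_forest par X"
    unfolding linear_forest_def
  proof
    fix v
    have "edge_degree par X v = card ((\<lambda>k. {g k, g (par k)}) ` {k \<in> X. k = v \<or> par k = v})"
      unfolding edge_degree_def using inj by (intro card_image[symmetric]) (auto elim: inj_on_subset)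
    also have "\<dots> \<le> card {e \<in> consecutive vs. g v \<in> e}"
      by (intro card_mono) (auto simp: X_def)
    also have "\<dots> \<le> 2"
      using assms(1) by (rule card_edges_at_le_2)
    finally show "edge_degree par X v \<le> 2" .
  qed
  have "consecutive vs \<inter> parent_edges g par m = (\<lambda>k. {g k, g (par k)}) ` X"
    by (auto simp: parent_edges_def X_def)
  then show "card (consecutive vs \<inter> parent_edges g par m) = card X"
    using inj by (simp add: card_image)
  have "supp par X \<subseteq> {..<m}"
  proof
    fix v assume "v \<in> supp par X"
    then obtain k where "k \<in> X" "v = k \<or> v = par k"
      by (auto simp: supp_def)
    then show "v \<in> {..<m}"
      using par[of k] by (auto simp: X_def)
  qed
  then have "card (supp par X) = card (g ` supp par X)"
    using assms(2) by (intro card_image[symmetric]) (auto elim: inj_on_subset)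
  also have "\<dots> \<le> card (set vs)"
  proof (intro card_mono subsetI)
    fix x assume "x \<in> g ` supp par X"
    then obtain k where "k \<in> X" "x \<in> {g k, g (par k)}"
      by (auto simp: supp_def)
    then obtain e where "e \<in> consecutive vs" "x \<in> e"
      by (auto simp: X_def)
    then show "x \<in> set vs"
      by (auto simp: consecutive_nth)
  qed simp
  finally show "card (supp par X) \<le> length vs"
    using assms(1) by (simp add: distinct_card)
qed

text \<open>The layout \<open>ws\<close> is put on an initial segment of \<open>vs\<close>. Only an
  inequality results, since a tree edge outside \<open>X\<close> may happen to join the ends of
  neighboring pieces.\<close>

lemma linear_forest_embedding:
  fixes vs :: "nat list"
  assumes vs: "distinct vs" and X: "linear_forest par X" "card (supp par X) \<le> length vs" "X \<subseteq> {1..<m}"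
    and par: "\<And>k. 0 < k \<Longrightarrow> k < m \<Longrightarrow> par k < k"
  obtains g where "inj_on g {..<m}" "card X \<le> card (consecutive vs \<inter> parent_edges g par m)"
proof -
  have fin: "finite X"
    using X(3) finite_subset by blast
  obtain ws where ws: "distinct ws" "set ws = supp par X" "\<And>k. k \<in> X \<Longrightarrow> {k, par k} \<in> consecutive ws"
    using linear_forest_layout[OF fin X(1)] X(3) par by (metis atLeastLessThan_iff less_eq_Suc_le One_nat_def subsetD)
  have len: "length ws \<le> length vs"
    using X(2) ws(1,2) by (simp flip: distinct_card)
  define idx where "idx = the_inv_into {..<length ws} ((!) ws)"
  have idx: "idx (ws ! i) = i" if "i < length ws" for i
    unfolding idx_def using that ws(1) by (intro the_inv_into_f_f inj_on_nth) auto
  \<comment> \<open>No entry of \<open>vs\<close> exceeds \<open>sum_list vs\<close>, so uncovered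
    vertices get names off the path, distinct for distinct \<open>k\<close>.\<close>
  define g where "g = (\<lambda>k. if k \<in> set ws then vs ! idx k else Suc (sum_list vs) + k)"
  have g_ws: "g (ws ! i) = vs ! i" if "i < length ws" for i
    using that idx by (simp add: g_def)
  have g_le: "g k \<le> sum_list vs" if k: "k \<in> set ws" for k
  proof -
    obtain i where "i < length ws" "k = ws ! i"
      using k by (auto simp: in_set_conv_nth)
    then show ?thesis
      using g_ws len by (simp add: member_le_sum_list)
  qed
  have g_other: "g k = Suc (sum_list vs) + k" if "k \<notin> set ws" for k
    using that by (simp add: g_def)
  have "inj g"
  proof (rule injI)
    fix a b assume ab: "g a = g b"
    show "a = b"
    proof (cases "a \<in> set ws")
      case True
      then have "b \<in> set ws"
        using ab g_le[of a] g_other[of b] by auto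
      then obtain i j where ij: "i < length ws" "j < length ws" "a = ws ! i" "b = ws ! j"
        using True by (metis in_set_conv_nth)
      then have "i = j"
        using ab g_ws len vs by (simp add: nth_eq_iff_index_eq)
      then show ?thesis
        using ij by simp
    next
      case False
      then have "b \<notin> set ws"
        using ab g_le[of b] g_other[of a] by auto
      then show ?thesis
        using ab False g_other by simp
    qed
  qed
  then have inj: "inj_on g {..<m}"
    by (rule inj_on_subset) simp
  have "X \<subseteq> {k \<in> {1..<m}. {g k, g (par k)} \<in> consecutive vs}"
  proof
    fix k assume k: "k \<in> X"
    then obtain i where i: "Suc i < length ws" "{k, par k} = {ws ! i, ws ! Suc i}"
      using ws(3) by (auto simp: consecutive_nth)
    have "g ` {k, par k} = {vs ! i, vs ! Suc i}"
      using i(1) g_ws unfolding i(2) by simp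
    then have "{g k, g (par k)} \<in> consecutive vs"
      using i(1) len by (auto simp: consecutive_nth)
    then show "k \<in> {k \<in> {1..<m}. {g k, g (par k)} \<in> consecutive vs}"
      using k X(3) by auto
  qed
  then have "card X \<le> card (consecutive vs \<inter> parent_edges g par m)"
    unfolding linear_forest_common_edges(3)[OF vs inj par, simplified] by (intro card_mono) auto
  then show ?thesis
    using that inj by blast
qed

text \<open>An optimal forest, embedded, gives the upper bound; the common edges of an arbitrary
  copy form a forest, which gives the lower bound. \<open>best\<close> is specified by the numbers
  below it, in the form in which the table cells deliver it.\<close>

lemma GED_path_tree:
  fixes G :: "(nat, 'l) lgraph" and H :: "('w, 'l) lgraph"
  assumes C: "counts_edge_edits C" and G: "is_graph G" "is_path G"
    and ord: "bij_betw ord {..<m} (verts H)" "edges H = parent_edges ord par m"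
    and par: "\<And>k. 0 < k \<Longrightarrow> k < m \<Longrightarrow> par k < k" and m: "0 < m"
    and best: "\<And>e. e < best \<longleftrightarrow> (\<exists>X \<subseteq> {1..<m}. linear_forest par X \<and>
      card (supp par X) \<le> card (verts G) \<and> e \<le> card X)"
  shows "GED G H C = of_nat (card (verts G) + m - best - best)"
proof -
  obtain vs where vs: "vs \<noteq> []" "distinct vs" "verts G = set vs" "edges G = consecutive vs"
    using G(2) unfolding is_path_def consecutive_nth by blast
  have n: "card (verts G) = length vs"
    using vs by (simp add: distinct_card)
  have cardG: "card (edges G) = length vs - 1"
    using vs card_consecutive by simp
  have cost: "card (sym_diff (edges G) (edges F)) + 2 * card (edges G \<inter> edges F) = (length vs - 1) + (m - 1)"
    if "edges F = parent_edges g par m" "inj_on g {..<m}" for F :: "(nat, 'l) lgraph" and g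
  proof -
    have "finite (edges F)" "card (edges F) = m - 1"
      using that inj_on_parent_edge[OF that(2) par] by (simp_all add: parent_edges_def card_image)
    then show ?thesis
      using card_sym_diff[of "edges G" "edges F"] cardG vs by simp
  qed
  \<comment> \<open>The empty forest; hence \<open>best - 1\<close> is a proper predecessor and is
    attained.\<close>
  have "0 < best"
    using best[of 0] by (auto intro!: exI[of _ "{}"])
  then obtain X where X: "X \<subseteq> {1..<m}" "linear_forest par X" "card (supp par X) \<le> length vs" "best - 1 \<le> card X"
    using best[of "best - 1"] n by auto
  have len: "0 < length vs"
    using vs by simp
  show ?thesis
  proof (rule antisym)
    obtain g where g: "inj_on g {..<m}" "card X \<le> card (edges G \<inter> parent_edges g par m)"
      using linear_forest_embedding[OF vs(2) X(2,3,1) par] unfolding vs(4) by blast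
    obtain F :: "(nat, 'l) lgraph" where F: "is_graph F" "isomorphic F H" "edges F = parent_edges g par m"
      using parent_edges_isomorphic[OF g(1) ord par] by blast
    have "card (sym_diff (edges G) (edges F)) \<le> length vs + m - best - best"
      using cost[OF F(3) g(1)] g(2) X(4) len m unfolding F(3) by linarith
    then show "GED G H C \<le> of_nat (card (verts G) + m - best - best)"
      using GED_le_card_sym_diff[OF C G(1) F(1,2)] unfolding n by (metis of_nat_mono order_trans)
    show "of_nat (card (verts G) + m - best - best) \<le> GED G H C"
    proof (rule GED_ge[OF C G(1)])
      fix F :: "(nat, 'l) lgraph" assume F: "is_graph F" "isomorphic F H"
      obtain g where g: "inj_on g {..<m}" "edges F = parent_edges g par m"
        using isomorphic_parent_edges[OF F ord par] by blast
      define Y where "Y = {k \<in> {1..<m}. {g k, g (par k)} \<in> consecutive vs}"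
      have Y: "linear_forest par Y" "card (supp par Y) \<le> length vs" "card (edges G \<inter> edges F) = card Y"
        using linear_forest_common_edges[OF vs(2) g(1) par] unfolding Y_def g(2) vs(4) by simp_all
      have "Y \<subseteq> {1..<m}"
        by (auto simp: Y_def)
      then have "card Y < best"
        using best[of "card Y"] Y n by auto
      then show "card (verts G) + m - best - best \<le> card (sym_diff (edges G) (edges F))"
        using cost[OF g(2,1)] Y(3) n by linarith
    qed
  qed
qed

section \<open>Spanning orders of trees\<close>

text \<open>If the new start already occurs on the path, the suffix from that occurrence on is
  kept.\<close>

lemma simple_path:
  assumes "(x, y) \<in> R\<^sup>*"
  shows "\<exists>vs. vs \<noteq> [] \<and> distinct vs \<and> hd vs = x \<and> last vs = y \<and> successively (\<lambda>a b. (a, b) \<in> R) vs"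
  using assms
proof (induction rule: converse_rtrancl_induct)
  case base
  show ?case
    by (intro exI[of _ "[y]"]) simp
next
  case (step x z)
  then obtain vs where vs: "vs \<noteq> []" "distinct vs" "hd vs = z" "last vs = y"
    "successively (\<lambda>a b. (a, b) \<in> R) vs"
    by blast
  show ?case
  proof (cases "x \<in> set vs")
    case True
    then obtain as bs where "vs = as @ x # bs"
      by (meson split_list)
    then show ?thesis
      using vs by (intro exI[of _ "x # bs"]) (auto simp: successively_append_iff split: if_splits)
  next
    case False
    then show ?thesis
      using vs step.hyps(1) by (intro exI[of _ "x # vs"]) (auto simp: successively_Cons)
  qed
qed

text \<open>The parent edges connect every vertex with the root, so a further edge would close a
  cycle together with a simple path along parent edges between its endpoints.\<close>

lemma tree_edges_eq_parent_edges:
  assumes tree: "is_tree H" and ord: "bij_betw ord {..<m} (verts H)"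
    and par: "\<And>k. 0 < k \<Longrightarrow> k < m \<Longrightarrow> par k < k"
    and sub: "parent_edges ord par m \<subseteq> edges H"
  shows "edges H = parent_edges ord par m"
proof (rule ccontr)
  assume "edges H \<noteq> parent_edges ord par m"
  then obtain e where e: "e \<in> edges H" "e \<notin> parent_edges ord par m"
    using sub by blast
  obtain x y where xy: "x \<in> verts H" "y \<in> verts H" "x \<noteq> y" "e = {x, y}"
    using tree e(1) unfolding is_tree_def is_graph_def by blast
  define R where "R = {(a, b). {a, b} \<in> parent_edges ord par m}"
  have sym: "sym R"
    by (auto simp: R_def sym_def insert_commute)
  have root: "(ord k, ord 0) \<in> R\<^sup>*" if "k < m" for k
    using that
  proof (induction k rule: less_induct)
    case (less k)
    show ?case
    proof (cases "k = 0")
      case False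
      then have "(ord k, ord (par k)) \<in> R"
        using less.prems by (auto simp: R_def parent_edges_def)
      moreover have "(ord (par k), ord 0) \<in> R\<^sup>*"
        using less par[of k] False by (metis gr0I less_trans)
      ultimately show ?thesis
        by (rule converse_rtrancl_into_rtrancl)
    qed simp
  qed
  have "(z, ord 0) \<in> R\<^sup>*" if z: "z \<in> verts H" for z
  proof -
    obtain k where "k < m" "z = ord k"
      using z ord unfolding bij_betw_def by auto
    then show ?thesis
      using root by simp
  qed
  then have "(x, ord 0) \<in> R\<^sup>*" "(y, ord 0) \<in> R\<^sup>*"
    using xy by blast+
  then have "(x, y) \<in> R\<^sup>*"
    using sym by (meson rtrancl_trans symD sym_rtrancl)
  then obtain vs where vs: "vs \<noteq> []" "distinct vs" "hd vs = x" "last vs = y"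
    "successively (\<lambda>a b. (a, b) \<in> R) vs"
    using simple_path by metis
  \<comment> \<open>A cycle needs three vertices: length 1 would mean \<open>x = y\<close>, and
    length 2 would make \<open>{x, y}\<close> a parent edge.\<close>
  have "length vs \<noteq> 1"
    using vs xy(3) by (auto simp: length_Suc_conv)
  moreover have "length vs \<noteq> 2"
  proof
    assume "length vs = 2"
    then have "vs = [x, y]"
      using vs by (auto simp: length_Suc_conv numeral_2_eq_2)
    then have "{x, y} \<in> parent_edges ord par m"
      using vs(5) by (simp add: R_def)
    then show False
      using e(2) xy(4) by simp
  qed
  ultimately have "3 \<le> length vs"
    using vs(1) by (metis One_nat_def Suc_leI le_neq_implies_less length_greater_0_conv numeral_2_eq_2 numeral_3_eq_3)
  moreover have "{vs ! i, vs ! Suc i} \<in> edges H" if "Suc i < length vs" for i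
    using vs(5) that sub unfolding successively_conv_nth R_def by auto
  moreover have "{last vs, hd vs} \<in> edges H"
    using vs e(1) xy(4) by (simp add: insert_commute)
  ultimately have "is_cycle_in H vs"
    unfolding is_cycle_in_def using vs(2) by blast
  then show False
    using tree unfolding is_tree_def by blast
qed

text \<open>A walk from inside \<open>W\<close> to outside has a step that leaves \<open>W\<close>;
  so the search never gets stuck before all vertices are found.\<close>

lemma connected_crossing_edge:
  assumes "connected_graph H" "W \<subseteq> verts H" "W \<noteq> {}" "W \<noteq> verts H" and H: "is_graph H"
  obtains p v where "p \<in> W" "v \<in> verts H - W" "{p, v} \<in> edges H"
proof -
  obtain a b where ab: "a \<in> W" "b \<in> verts H" "b \<notin> W"
    using assms by blast
  have "(a, b) \<in> {(x, y). {x, y} \<in> edges H}\<^sup>*"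
    using assms(1,2) ab unfolding connected_graph_def by blast
  then have "b \<in> W \<or> (\<exists>p v. p \<in> W \<and> v \<notin> W \<and> {p, v} \<in> edges H)"
    by (induction rule: rtrancl_induct) (use ab in auto)
  then obtain p v where pv: "p \<in> W" "v \<notin> W" "{p, v} \<in> edges H"
    using ab by blast
  then have "v \<in> verts H"
    using H unfolding is_graph_def by (metis insert_iff singletonD)
  then show ?thesis
    using that pv by blast
qed

section \<open>Dynamic programming over a tree\<close>

text \<open>
  An entry consists of the degree of the root of a subtree in a linear forest, the number of vertices
  that the forest covers, and a lower bound on its number of edges. In \<open>merge\<close>, the number \<open>u\<close> tells
  whether the edge between the two roots is used; it covers a root that had degree 0 before.
\<close>

type_synonym entry = "nat \<times> nat \<times> nat"

definition merge :: "entry set \<Rightarrow> entry set \<Rightarrow> entry set" where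
  "merge A B = {(d1 + u, j1 + j2 + (u - d1) + (u - d2), e) | d1 j1 e1 d2 j2 e2 u e.
     (d1, j1, e1) \<in> A \<and> (d2, j2, e2) \<in> B \<and> u \<le> 1 \<and> d1 + u \<le> 2 \<and> d2 + u \<le> 2 \<and> e \<le> e1 + e2 + u}"

lemma mergeI:
  assumes "(d1, j1, e1) \<in> A" "(d2, j2, e2) \<in> B" "u \<le> 1" "d1 + u \<le> 2" "d2 + u \<le> 2"
    and "e \<le> e1 + e2 + u"
  shows "(d1 + u, j1 + j2 + (u - d1) + (u - d2), e) \<in> merge A B"
  using assms unfolding merge_def by blast

text \<open>The tables after the vertices \<open>m - 1, \<dots>, m - t\<close> have been merged into their parents.\<close>

fun tables :: "(nat \<Rightarrow> nat) \<Rightarrow> nat \<Rightarrow> nat \<Rightarrow> nat \<Rightarrow> entry set" where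
  "tables par m 0 = (\<lambda>v. {(0, 0, 0)})"
| "tables par m (Suc t) = (let i = m - Suc t; T = tables par m t in
     T(par i := merge (T (par i)) (T i)))"

section \<open>Completeness and soundness of the tables\<close>

text \<open>The truncated difference is 1 exactly at an endpoint not covered before, which explains
  the terms \<open>u - d1\<close> and \<open>u - d2\<close> in \<open>merge\<close>.\<close>

lemma card_supp_insert:
  assumes "finite X" "par i \<noteq> i"
  shows "card (supp par (insert i X)) =
    card (supp par X) + (1 - edge_degree par X i) + (1 - edge_degree par X (par i))"
proof -
  have "1 - edge_degree par X v = (if v \<in> supp par X then 0 else 1)" for v
    using edge_degree_pos_iff[OF assms(1), of par v] by auto
  then show ?thesis
    using assms by (auto simp: supp_insert card_insert_if)
qed

text \<open>Bookkeeping for one merge: the summands of \<open>p\<close> and of the last vertex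
  \<open>i\<close> become one summand, with \<open>c\<close> as gain.\<close>

lemma sum_merge_two:
  fixes f g :: "nat \<Rightarrow> nat"
  assumes "p < i" "\<And>v. v < i \<Longrightarrow> v \<noteq> p \<Longrightarrow> f v = g v" "f p = g p + g i + c"
  shows "sum f {..<i} = sum g {..<Suc i} + c"
proof -
  have "sum f {..<i} = f p + sum f ({..<i} - {p})" "sum g {..<i} = g p + sum g ({..<i} - {p})"
    using assms(1) by (auto simp: sum.remove)
  moreover have "sum f ({..<i} - {p}) = sum g ({..<i} - {p})"
    using assms(2) by (intro sum.cong) auto
  ultimately show ?thesis
    using assms(3) by simp
qed

text \<open>
  In the next two lemmas, summing over all vertices that are not merged yet makes it unnecessary to
  describe the subtrees that belong to them.
\<close>

lemma tables_complete:
  assumes par: "\<And>k. 0 < k \<Longrightarrow> k < m \<Longrightarrow> par k < k"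
    and "t < m" "X \<subseteq> {m - t..<m}" "linear_forest par X"
  shows "\<exists>j e. (\<forall>v < m - t. (edge_degree par X v, j v, e v) \<in> tables par m t v) \<and>
    sum j {..<m - t} = card (supp par X) \<and> sum e {..<m - t} = card X"
  using assms(2-)
proof (induction t arbitrary: X)
  case 0
  then have "X = {}"
    by simp
  then show ?case
    by (intro exI[of _ "\<lambda>_. 0"]) simp
next
  case (Suc t)
  define i where "i = m - Suc t"
  have i: "0 < i" "i < m" "m - t = Suc i"
    using Suc.prems(1) by (auto simp: i_def)
  define p where "p = par i"
  have p: "p < i"
    using par i by (simp add: p_def)
  \<comment> \<open>Without the edge of \<open>i\<close>, the forest is one for the tables before
    this merge.\<close>
  define Y where "Y = X - {i}"
  have fin: "finite X" "finite Y"
    using Suc.prems(2) finite_subset unfolding Y_def by auto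
  have Y: "Y \<subseteq> {m - t..<m}" "linear_forest par Y"
    using Suc.prems linear_forest_subset[OF Suc.prems(3) _ fin(1)] i
    by (auto simp: Y_def i_def[symmetric])
  define u where "u = (if i \<in> X then 1 else 0 :: nat)"
  have X: "X = (if i \<in> X then insert i Y else Y)"
    by (auto simp: Y_def)
  have deg: "edge_degree par X v = edge_degree par Y v + (if v = i \<or> v = p then u else 0)" for v
    using edge_degree_insert[OF fin(2), of i par v] by (subst X) (auto simp: u_def Y_def p_def)
  have supp: "card (supp par X) =
      card (supp par Y) + (u - edge_degree par Y i) + (u - edge_degree par Y p)"
    using card_supp_insert[OF fin(2), of par i] p by (subst X) (auto simp: u_def p_def)
  have card: "card X = card Y + u"
    using card_Suc_Diff1[OF fin(1), of i] by (auto simp: u_def Y_def)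
  obtain j e where je: "\<And>v. v < Suc i \<Longrightarrow> (edge_degree par Y v, j v, e v) \<in> tables par m t v"
    "sum j {..<Suc i} = card (supp par Y)" "sum e {..<Suc i} = card Y"
    using Suc.IH[OF _ Y] Suc.prems(1) unfolding i(3) by auto
  define j' where "j' = j(p := j p + j i + ((u - edge_degree par Y i) + (u - edge_degree par Y p)))"
  define e' where "e' = e(p := e p + e i + u)"
  have "(edge_degree par X p, j' p, e' p) \<in> merge (tables par m t p) (tables par m t i)"
  proof -
    have u: "u \<le> 1"
      by (simp add: u_def)
    have le: "edge_degree par Y p + u \<le> 2" "edge_degree par Y i + u \<le> 2"
      using Suc.prems(3)[unfolded linear_forest_def, THEN spec, of p]
        Suc.prems(3)[unfolded linear_forest_def, THEN spec, of i] deg[of p] deg[of i] by simp_all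
    have "(edge_degree par Y p + u,
        j p + j i + (u - edge_degree par Y p) + (u - edge_degree par Y i), e p + e i + u)
        \<in> merge (tables par m t p) (tables par m t i)"
      using je(1) p u le by (intro mergeI) auto
    then show ?thesis
      by (simp add: deg j'_def e'_def algebra_simps)
  qed
  then have "\<forall>v < i. (edge_degree par X v, j' v, e' v) \<in> tables par m (Suc t) v"
    using je(1) deg p by (auto simp: Let_def i_def[symmetric] p_def[symmetric] j'_def e'_def)
  moreover have "sum j' {..<i} = card (supp par X)"
    using sum_merge_two[OF p, of j' j] je(2) supp by (simp add: j'_def)
  moreover have "sum e' {..<i} = card X"
    using sum_merge_two[OF p, of e' e] je(3) card by (simp add: e'_def)
  ultimately show ?case
    unfolding i_def by blast
qed

lemma tables_sound:
  assumes par: "\<And>k. 0 < k \<Longrightarrow> k < m \<Longrightarrow> par k < k"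
    and "t < m" "\<And>v. v < m - t \<Longrightarrow> (d v, j v, e v) \<in> tables par m t v"
  shows "\<exists>X \<subseteq> {m - t..<m}. linear_forest par X \<and> (\<forall>v < m - t. edge_degree par X v = d v) \<and>
    card (supp par X) = sum j {..<m - t} \<and> sum e {..<m - t} \<le> card X"
  using assms(2-)
proof (induction t arbitrary: d j e)
  case 0
  then show ?case
    by (intro exI[of _ "{}"]) simp
next
  case (Suc t)
  define i where "i = m - Suc t"
  have i: "0 < i" "i < m" "m - t = Suc i"
    using Suc.prems(1) by (auto simp: i_def)
  define p where "p = par i"
  have p: "p < i"
    using par i by (simp add: p_def)
  have tab: "(d v, j v, e v) \<in> tables par m t v" if "v < i" "v \<noteq> p" for v
    using Suc.prems(2)[of v] that by (auto simp: Let_def i_def p_def)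
  have "(d p, j p, e p) \<in> merge (tables par m t p) (tables par m t i)"
    using Suc.prems(2)[of p] p by (auto simp: Let_def i_def p_def)
  then obtain d1 j1 e1 d2 j2 e2 u where q: "(d1, j1, e1) \<in> tables par m t p"
    "(d2, j2, e2) \<in> tables par m t i" "u \<le> 1" "d1 + u \<le> 2" "d2 + u \<le> 2"
    "d p = d1 + u" "j p = j1 + j2 + (u - d1) + (u - d2)" "e p \<le> e1 + e2 + u"
    unfolding merge_def by auto
  \<comment> \<open>The chosen entries before the merge: \<open>p\<close> and \<open>i\<close> have
    separate ones again, all other vertices keep theirs.\<close>
  define d' where "d' = d(p := d1, i := d2)"
  define j' where "j' = j(p := j1, i := j2)"
  define e' where "e' = e(p := e1, i := e2)"
  have "(d' v, j' v, e' v) \<in> tables par m t v" if "v < m - t" for v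
    using that tab q(1,2) unfolding i(3) by (auto simp: d'_def j'_def e'_def less_Suc_eq)
  then obtain Y where Y: "Y \<subseteq> {m - t..<m}" "linear_forest par Y"
    "\<And>v. v < Suc i \<Longrightarrow> edge_degree par Y v = d' v"
    "card (supp par Y) = sum j' {..<Suc i}" "sum e' {..<Suc i} \<le> card Y"
    using Suc.IH[of d' j' e'] Suc.prems(1) unfolding i(3) by auto
  have fin: "finite Y"
    using Y(1) finite_subset by auto
  have iY: "i \<notin> Y"
    using Y(1) i(3) by auto
  have dY: "edge_degree par Y p = d1" "edge_degree par Y i = d2"
    using Y(3)[of p] Y(3)[of i] p by (auto simp: d'_def)
  define X where "X = (if u = 0 then Y else insert i Y)"
  have u: "u = 0 \<or> u = 1"
    using q(3) by auto
  have deg: "edge_degree par X v = edge_degree par Y v + (if v = i \<or> v = p then u else 0)" for v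
    using edge_degree_insert[OF fin iY, of par v] u by (auto simp: X_def p_def)
  have supp: "card (supp par X) = card (supp par Y) + ((u - d1) + (u - d2))"
    using card_supp_insert[OF fin, of par i] p u dY by (auto simp: X_def p_def)
  have card: "card X = card Y + u"
    using fin iY u by (auto simp: X_def)
  have "linear_forest par X"
    using Y(2) dY q(4,5) unfolding linear_forest_def deg by auto
  moreover have "X \<subseteq> {i..<m}"
    using Y(1) i by (auto simp: X_def)
  moreover have "\<forall>v<i. edge_degree par X v = d v"
    using Y(3) q(6) dY by (auto simp: deg d'_def)
  moreover have "sum j {..<i} = sum j' {..<Suc i} + ((u - d1) + (u - d2))"
    using sum_merge_two[OF p, of j j'] q(7) p by (simp add: j'_def)
  then have "card (supp par X) = sum j {..<i}"
    using supp Y(4) by simp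
  moreover have "sum e {..<i} \<le> card X"
  proof -
    \<comment> \<open>\<open>e p\<close> is only a lower bound, so it is raised to the value for
      which the bookkeeping is exact.\<close>
    have "sum e {..<i} \<le> sum (e(p := e1 + e2 + u)) {..<i}"
      using q(8) by (intro sum_mono) auto
    also have "\<dots> = sum e' {..<Suc i} + u"
      using sum_merge_two[OF p, of "e(p := e1 + e2 + u)" e'] p by (simp add: e'_def)
    finally show ?thesis
      using Y(5) card by simp
  qed
  ultimately show ?case
    unfolding i_def by blast
qed

section \<open>The program\<close>

text \<open>The machine cannot multiply, so addresses are computed from tables of multiples.\<close>

definition multiples :: "string \<Rightarrow> string \<Rightarrow> aexp \<Rightarrow> com" where
  "multiples r x bnd = For ''i'' bnd (Assign r (Plus (Sc ''i'') (N 1)) (Plus (Acc r (Sc ''i'')) (Sc x)))"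

text \<open>The encoding of the path has length \<open>1 + n + n * n\<close>, so \<open>m\<close>
  comes next, and after it and \<open>m\<close> labels the matrix of the tree starts at
  \<open>b\<close>. \<open>K\<close> exceeds \<open>2 * n + 2\<close>, the largest number of covered
  vertices arising from two cells with at most \<open>n\<close> each.\<close>

definition read_sizes :: com where
  "read_sizes =
     ''n'' ::= Acc ''in'' (N 0) ;;
     For ''i'' (Sc ''n'') (''sq'' ::= Plus (Sc ''sq'') (Sc ''n'')) ;;
     ''m'' ::= Acc ''in'' (Plus (N 1) (Plus (Sc ''n'') (Sc ''sq''))) ;;
     ''b'' ::= Plus (N 2) (Plus (Plus (Sc ''n'') (Sc ''sq'')) (Sc ''m'')) ;;
     ''K'' ::= Plus (N 3) (Plus (Sc ''n'') (Sc ''n''))"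

text \<open>Each round appends an unvisited vertex \<open>c\<close> adjacent to the one at position
  \<open>q\<close>. \<open>par\<close> holds positions in the order, not vertices, so parents are
  smaller numbers. The root is vertex 0, as the cell 0 of \<open>ord\<close> is initially 0.\<close>

definition find_order :: com where
  "find_order =
     Assign ''vis'' (N 0) (N 1) ;;
     For ''i'' (Minus (Sc ''m'') (N 1)) (
       For ''v'' (Sc ''m'') (For ''k'' (Plus (Sc ''i'') (N 1)) (
         If (And (Eq (Acc ''vis'' (Sc ''v'')) (N 0))
               (Less (N 0) (Acc ''in'' (Plus (Sc ''b'')
                 (Plus (Acc ''rm'' (Acc ''ord'' (Sc ''k''))) (Sc ''v''))))))
           (''c'' ::= Sc ''v'' ;; ''q'' ::= Sc ''k'') Skip)) ;;
       Assign ''ord'' (Plus (Sc ''i'') (N 1)) (Sc ''c'') ;;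
       Assign ''par'' (Plus (Sc ''i'') (N 1)) (Sc ''q'') ;;
       Assign ''vis'' (Sc ''c'') (N 1))"

text \<open>
  The table with number \<open>id\<close> occupies three rows of length \<open>K = 2 n + 3\<close>, one for each degree of
  the root. A cell holds one more than the number of edges, or 0 if there is no forest.
\<close>

definition cell_addr :: "aexp \<Rightarrow> aexp \<Rightarrow> aexp \<Rightarrow> aexp" where
  "cell_addr a d j = Plus (Acc ''rk'' (Plus (Plus a (Plus a a)) d)) j"

definition init_tables :: com where
  "init_tables = For ''v'' (Sc ''m'') (
     Assign ''T'' (cell_addr (Sc ''v'') (N 0) (N 0)) (N 1) ;;
     Assign ''cur'' (Sc ''v'') (Sc ''v''))"

text \<open>Both cells carry the offset one, so a single 1 is subtracted in \<open>h\<close>. The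
  last test keeps the maximum.\<close>

definition combine_cells :: com where
  "combine_cells =
     ''x'' ::= Acc ''T'' (cell_addr (Sc ''a'') (Sc ''d1'') (Sc ''j1'')) ;;
     ''y'' ::= Acc ''T'' (cell_addr (Sc ''c'') (Sc ''d2'') (Sc ''j2'')) ;;
     ''w'' ::= cell_addr (Sc ''z'') (Plus (Sc ''d1'') (Sc ''u''))
       (Plus (Plus (Sc ''j1'') (Sc ''j2''))
         (Plus (Minus (Sc ''u'') (Sc ''d1'')) (Minus (Sc ''u'') (Sc ''d2'')))) ;;
     ''h'' ::= Minus (Plus (Plus (Sc ''x'') (Sc ''y'')) (Sc ''u'')) (N 1) ;;
     If (And (And (Less (N 0) (Sc ''x'')) (Less (N 0) (Sc ''y'')))
         (And (And (Less (Plus (Sc ''d1'') (Sc ''u'')) (N 3)) (Less (Plus (Sc ''d2'') (Sc ''u'')) (N 3)))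
           (Less (Acc ''T'' (Sc ''w'')) (Sc ''h''))))
       (Assign ''T'' (Sc ''w'') (Sc ''h'')) Skip"

text \<open>Cells with more than \<open>n\<close> covered vertices can be written but are never
  read: further merging only increases that number.\<close>

definition combine_tables :: com where
  "combine_tables =
     For ''d1'' (N 3) (For ''j1'' (Plus (Sc ''n'') (N 1)) (
     For ''d2'' (N 3) (For ''j2'' (Plus (Sc ''n'') (N 1)) (
     For ''u'' (N 2) combine_cells))))"

text \<open>
  The table that results from merging the vertex \<open>i\<close> gets the number \<open>m + i\<close>, whose cells are still 0.
\<close>

definition process_tree :: com where
  "process_tree = For ''t'' (Minus (Sc ''m'') (N 1)) (
     ''i'' ::= Minus (Minus (Sc ''m'') (N 1)) (Sc ''t'') ;;
     ''p'' ::= Acc ''par'' (Sc ''i'') ;;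
     ''a'' ::= Acc ''cur'' (Sc ''p'') ;;
     ''c'' ::= Acc ''cur'' (Sc ''i'') ;;
     ''z'' ::= Plus (Sc ''m'') (Sc ''i'') ;;
     combine_tables ;;
     Assign ''cur'' (Sc ''p'') (Sc ''z''))"

definition find_best :: com where
  "find_best =
     ''a'' ::= Acc ''cur'' (N 0) ;;
     For ''d1'' (N 3) (For ''j1'' (Plus (Sc ''n'') (N 1)) (
       ''x'' ::= Acc ''T'' (cell_addr (Sc ''a'') (Sc ''d1'') (Sc ''j1'')) ;;
       If (Less (Sc ''best'') (Sc ''x'')) (''best'' ::= Sc ''x'') Skip)) ;;
     ''out'' ::= Minus (Minus (Plus (Sc ''n'') (Sc ''m'')) (Sc ''best'')) (Sc ''best'')"

text \<open>Multiples of \<open>K\<close> are needed up to \<open>6 * m\<close>: there are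
  \<open>2 * m\<close> tables with three rows each, and row \<open>6 * m\<close> can occur when the
  address for degree 3 is computed before the test rejects it.\<close>

definition ged_program :: com where
  "ged_program =
     read_sizes ;;
     multiples ''rm'' ''m'' (Sc ''m'') ;;
     multiples ''rk'' ''K'' (Plus (Plus (Plus (Sc ''m'') (Sc ''m'')) (Plus (Sc ''m'') (Sc ''m'')))
       (Plus (Sc ''m'') (Sc ''m''))) ;;
     find_order ;; init_tables ;; process_tree ;; find_best"

section \<open>Correctness of the phases of the program\<close>

lemma read_sizes_correct:
  assumes "s ''in'' 0 = n" "s ''in'' (1 + n + n * n) = m" "s ''sq'' 0 = 0" "n \<le> L"
  shows "wp L read_sizes (\<lambda>s'. s' ''n'' 0 = n \<and> s' ''m'' 0 = m \<and> s' ''b'' 0 = 2 + n + n * n + m \<and>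
    s' ''K'' 0 = 3 + 2 * n) s"
proof -
  have "wp L (For ''i'' (Sc ''n'') (''sq'' ::= Plus (Sc ''sq'') (Sc ''n'')))
    (\<lambda>s'. s' ''n'' 0 = n \<and> s' ''in'' = s ''in'' \<and> s' ''sq'' 0 = n * n) (s(''n'' := (s ''n'')(0 := n)))"
  proof (rule wp_For[where I = "\<lambda>i s'. s' ''n'' 0 = n \<and> s' ''in'' = s ''in'' \<and> s' ''sq'' 0 = i * n" and n = n],
      goal_cases)
    case (6 i s')
    then show ?case
      by (intro wp_Assign) simp
  qed (use assms in simp_all)
  moreover have "wp L (''m'' ::= Acc ''in'' (Plus (N 1) (Plus (Sc ''n'') (Sc ''sq''))) ;;
     ''b'' ::= Plus (N 2) (Plus (Plus (Sc ''n'') (Sc ''sq'')) (Sc ''m'')) ;;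
     ''K'' ::= Plus (N 3) (Plus (Sc ''n'') (Sc ''n'')))
    (\<lambda>s'. s' ''n'' 0 = n \<and> s' ''m'' 0 = m \<and> s' ''b'' 0 = 2 + n + n * n + m \<and> s' ''K'' 0 = 3 + 2 * n) s'"
    if "s' ''n'' 0 = n \<and> s' ''in'' = s ''in'' \<and> s' ''sq'' 0 = n * n" for s'
    using that assms(2) by (intro wp_Seq wp_Assign) simp
  ultimately show ?thesis
    unfolding read_sizes_def
    by (intro wp_Seq wp_Assign) (simp add: assms(1), erule wp_frame, blast)
qed

lemma multiples_correct:
  assumes "aval bnd s = k" "k \<le> L" "reads bnd \<inter> {''i'', r} = {}" "r \<noteq> ''i''" "x \<noteq> ''i''" "x \<noteq> r"
    and "s r 0 = 0"
  shows "wp L (multiples r x bnd) (\<lambda>s'. \<forall>q \<le> k. s' r q = q * s x 0) s"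
  unfolding multiples_def
proof (rule wp_For[where I = "\<lambda>i s'. \<forall>q \<le> i. s' r q = q * s x 0" and n = k], goal_cases)
  case (6 i s')
  then show ?case
    using assms by (intro wp_Assign) (simp add: le_Suc_eq)
qed (use assms in simp_all)

text \<open>\<open>c\<close> and \<open>q\<close> hold the candidate found last; they are meaningful
  as soon as the set of candidates met so far is nonempty.\<close>

lemma find_candidate_correct:
  assumes "s ''m'' 0 = m" "s ''i'' 0 = i" "m \<le> L" "Suc i \<le> L"
    and Cand: "Cand = {(v, k). v < m \<and> k \<le> i \<and> s ''vis'' v = 0 \<and>
      0 < s ''in'' (s ''b'' 0 + (s ''rm'' (s ''ord'' k) + v))}"
    and "Cand \<noteq> {}"
  shows "wp L (For ''v'' (Sc ''m'') (For ''k'' (Plus (Sc ''i'') (N 1)) (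
         If (And (Eq (Acc ''vis'' (Sc ''v'')) (N 0))
               (Less (N 0) (Acc ''in'' (Plus (Sc ''b'')
                 (Plus (Acc ''rm'' (Acc ''ord'' (Sc ''k''))) (Sc ''v''))))))
           (''c'' ::= Sc ''v'' ;; ''q'' ::= Sc ''k'') Skip)))
     (\<lambda>s'. (s' ''c'' 0, s' ''q'' 0) \<in> Cand) s"
    (is "wp L (For _ _ (For _ _ ?body)) _ s")
proof -
  define I where "I = (\<lambda>(R :: (nat \<times> nat) set) (s' :: state). R \<noteq> {} \<longrightarrow> (s' ''c'' 0, s' ''q'' 0) \<in> Cand)"
  have body: "wp L ?body (I (R \<union> (Cand \<inter> {(v, k)}))) s2"
    if "v < m" "k < Suc i" "I R s2" "s2 ''v'' 0 = v" "s2 ''k'' 0 = k"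
      "\<And>y. y \<notin> {''v'', ''k'', ''c'', ''q''} \<Longrightarrow> s2 y = s y" for R v k s2
    using that by (intro wp_If wp_Seq wp_Assign wp_Skip) (auto simp: I_def Cand)
  have "wp L (For ''v'' (Sc ''m'') (For ''k'' (Plus (Sc ''i'') (N 1)) ?body))
      (I ({} \<union> (\<Union>v<m. \<Union>k<Suc i. Cand \<inter> {(v, k)}))) s"
  proof (rule wp_For_accum)
    fix v s1 R assume 1: "v < m" "I R s1" "s1 ''v'' 0 = v"
      "\<And>y. y \<notin> insert ''v'' (writes (For ''k'' (Plus (Sc ''i'') (N 1)) ?body)) \<Longrightarrow> s1 y = s y"
    show "wp L (For ''k'' (Plus (Sc ''i'') (N 1)) ?body) (I (R \<union> (\<Union>k<Suc i. Cand \<inter> {(v, k)}))) s1"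
    proof (rule wp_For_accum)
      fix k s2 R assume 2: "k < Suc i" "I R s2" "s2 ''k'' 0 = k"
        "\<And>y. y \<notin> insert ''k'' (writes ?body) \<Longrightarrow> s2 y = s1 y"
      show "wp L ?body (I (R \<union> (Cand \<inter> {(v, k)}))) s2"
        by (rule body) (use 1 2 in simp_all)
    qed (use assms 1 in \<open>simp_all add: I_def\<close>)
  qed (use assms in \<open>simp_all add: I_def\<close>)
  moreover have "(\<Union>v<m. \<Union>k<Suc i. Cand \<inter> {(v, k)}) = Cand"
    by (auto simp: Cand)
  ultimately show ?thesis
    using assms(6) by (simp add: I_def)
qed

lemma find_order_correct:
  assumes "s ''m'' 0 = m" "0 < m" "m \<le> L" "\<And>v. s ''vis'' v = 0" "s ''ord'' 0 = 0"
    and adj: "\<And>u v. u < m \<Longrightarrow> v < m \<Longrightarrow> 0 < s ''in'' (s ''b'' 0 + (s ''rm'' u + v)) \<longleftrightarrow> E u v"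
    and crossing: "\<And>W. W \<subseteq> {..<m} \<Longrightarrow> W \<noteq> {} \<Longrightarrow> W \<noteq> {..<m} \<Longrightarrow> \<exists>p \<in> W. \<exists>v < m. v \<notin> W \<and> E p v"
  shows "wp L find_order (\<lambda>s'. inj_on (s' ''ord'') {..<m} \<and> (\<forall>k < m. s' ''ord'' k < m) \<and>
    (\<forall>k. 0 < k \<longrightarrow> k < m \<longrightarrow> s' ''par'' k < k \<and> E (s' ''ord'' (s' ''par'' k)) (s' ''ord'' k))) s"
    (is "wp L find_order ?Q s")
proof -
  define I where "I = (\<lambda>i (s' :: state). inj_on (s' ''ord'') {..i} \<and> (\<forall>k \<le> i. s' ''ord'' k < m) \<and>
    (\<forall>k. 0 < k \<longrightarrow> k \<le> i \<longrightarrow> s' ''par'' k < k \<and> E (s' ''ord'' (s' ''par'' k)) (s' ''ord'' k)) \<and>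
    (\<forall>v < m. s' ''vis'' v = 0 \<longleftrightarrow> v \<notin> s' ''ord'' ` {..i}))"
  show ?thesis
    unfolding find_order_def
  proof (intro wp_Seq wp_Assign, rule wp_For[where I = I and n = "m - 1"], goal_cases)
    case (5)
    show ?case
      using assms(2,4,5) by (simp add: I_def)
  next
    case (6 i s1)
    define Cand where "Cand = {(v, k). v < m \<and> k \<le> i \<and> s1 ''vis'' v = 0 \<and>
      0 < s1 ''in'' (s1 ''b'' 0 + (s1 ''rm'' (s1 ''ord'' k) + v))}"
    have I: "inj_on (s1 ''ord'') {..i}" "\<And>k. k \<le> i \<Longrightarrow> s1 ''ord'' k < m"
      "\<And>k. 0 < k \<Longrightarrow> k \<le> i \<Longrightarrow> s1 ''par'' k < k \<and> E (s1 ''ord'' (s1 ''par'' k)) (s1 ''ord'' k)"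
      "\<And>v. v < m \<Longrightarrow> s1 ''vis'' v = 0 \<longleftrightarrow> v \<notin> s1 ''ord'' ` {..i}"
      using 6(2) by (auto simp: I_def)
    have same: "s1 ''in'' = s ''in''" "s1 ''b'' = s ''b''" "s1 ''rm'' = s ''rm''" "s1 ''m'' = s ''m''"
      using 6(4) by simp_all
    have Cand: "(v, k) \<in> Cand \<longleftrightarrow> v < m \<and> k \<le> i \<and> v \<notin> s1 ''ord'' ` {..i} \<and> E (s1 ''ord'' k) v" for v k
      using I(2)[of k] I(4)[of v] adj[of "s1 ''ord'' k" v] by (auto simp: Cand_def same)
    have "Cand \<noteq> {}"
    proof -
      \<comment> \<open>Only \<open>i + 1 < m\<close> vertices have been placed, so an edge leaves
        the set of placed vertices.\<close>
      have "card (s1 ''ord'' ` {..i}) < m"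
        using I(1) 6(1) by (simp add: card_image)
      then have "s1 ''ord'' ` {..i} \<noteq> {..<m}"
        by auto
      then obtain p v where "p \<in> s1 ''ord'' ` {..i}" "v < m" "v \<notin> s1 ''ord'' ` {..i}" "E p v"
        using crossing[of "s1 ''ord'' ` {..i}"] I(2) by blast
      then show ?thesis
        using Cand by blast
    qed
    then have cand: "wp L (For ''v'' (Sc ''m'') (For ''k'' (Plus (Sc ''i'') (N 1)) (
         If (And (Eq (Acc ''vis'' (Sc ''v'')) (N 0))
               (Less (N 0) (Acc ''in'' (Plus (Sc ''b'')
                 (Plus (Acc ''rm'' (Acc ''ord'' (Sc ''k''))) (Sc ''v''))))))
           (''c'' ::= Sc ''v'' ;; ''q'' ::= Sc ''k'') Skip)))
     (\<lambda>s'. (s' ''c'' 0, s' ''q'' 0) \<in> Cand) s1"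
      using 6(1,3) assms(1,3) same(4) by (intro find_candidate_correct) (auto simp: Cand_def)
    show ?case
    proof (rule wp_Seq, rule wp_frame[OF cand], intro wp_Seq wp_Assign, goal_cases)
      case (1 s2)
      define c q where "c = s2 ''c'' 0" and "q = s2 ''q'' 0"
      have cq: "c < m" "q \<le> i" "c \<notin> s1 ''ord'' ` {..i}" "E (s1 ''ord'' q) c"
        using 1(1) Cand by (auto simp: c_def q_def)
      have same2: "s2 ''ord'' = s1 ''ord''" "s2 ''par'' = s1 ''par''" "s2 ''vis'' = s1 ''vis''"
        "s2 ''i'' 0 = i"
        using 1(2) 6(3) by simp_all
      define ord par vis where "ord = (s1 ''ord'')(Suc i := c)" and "par = (s1 ''par'')(Suc i := q)"
        and "vis = (s1 ''vis'')(c := 1)"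
      have img: "ord ` {..Suc i} = insert c (s1 ''ord'' ` {..i})"
        by (auto simp: ord_def atMost_Suc)
      have "inj_on ord {..Suc i}"
        using I(1) cq(3) by (auto simp: ord_def inj_on_def atMost_Suc)
      moreover have "\<forall>k \<le> Suc i. ord k < m"
        using I(2) cq(1) by (auto simp: ord_def le_Suc_eq)
      moreover have "par k < k \<and> E (ord (par k)) (ord k)" if "0 < k" "k \<le> Suc i" for k
        using I(3)[of k] that cq(2,4) by (auto simp: ord_def par_def le_Suc_eq)
      moreover have "\<forall>v < m. vis v = 0 \<longleftrightarrow> v \<notin> ord ` {..Suc i}"
        using I(4) unfolding img by (auto simp: vis_def)
      ultimately have "I (Suc i) s'" if "s' ''ord'' = ord" "s' ''par'' = par" "s' ''vis'' = vis" for s'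
        unfolding I_def that by blast
      note I_Suc = this
      show ?case
        by (rule I_Suc) (simp_all add: same2 ord_def par_def vis_def c_def q_def)
    qed
  next
    case (7 s1)
    have "{..m - 1} = {..<m}" "\<And>k. k \<le> m - 1 \<longleftrightarrow> k < m"
      using assms(2) by auto
    then show ?case
      using 7(1) by (simp add: I_def)
  qed (use assms in auto)
qed

definition addr :: "nat \<Rightarrow> nat \<Rightarrow> nat \<Rightarrow> nat \<Rightarrow> nat" where
  "addr K a d j = (a + (a + a) + d) * K + j"

text \<open>Division by \<open>K\<close> separates \<open>j\<close> from the row, and the row
  determines \<open>a\<close> and \<open>d\<close> because \<open>d < 3\<close>.\<close>

lemma addr_inject:
  assumes "d < 3" "d' < 3" "j < K" "j' < K"
  shows "addr K a d j = addr K a' d' j' \<longleftrightarrow> a = a' \<and> d = d' \<and> j = j'"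
proof
  assume eq: "addr K a d j = addr K a' d' j'"
  then have "(addr K a d j) mod K = (addr K a' d' j') mod K"
    "(addr K a d j) div K = (addr K a' d' j') div K"
    by simp_all
  then have "j = j'" "a + (a + a) + d = a' + (a' + a') + d'"
    using assms(3,4) by (simp_all add: addr_def)
  then show "a = a' \<and> d = d' \<and> j = j'"
    using assms(1,2) by presburger
qed simp

lemma init_tables_correct:
  assumes "s ''m'' 0 = m" "m \<le> L" "\<And>q. q \<le> 6 * m \<Longrightarrow> s ''rk'' q = q * K" "\<And>q. s ''T'' q = 0" "0 < K"
  shows "wp L init_tables (\<lambda>s'. (\<forall>v < m. s' ''cur'' v = v) \<and> (\<forall>a d j. d < 3 \<longrightarrow> j < K \<longrightarrow>
    s' ''T'' (addr K a d j) = (if a < m \<and> d = 0 \<and> j = 0 then 1 else 0))) s"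
  unfolding init_tables_def
proof (rule wp_For[where n = m and I = "\<lambda>i s'. (\<forall>v < i. s' ''cur'' v = v) \<and> (\<forall>a d j. d < 3 \<longrightarrow> j < K \<longrightarrow>
    s' ''T'' (addr K a d j) = (if a < i \<and> d = 0 \<and> j = 0 then 1 else 0))"], goal_cases)
  case (6 i s1)
  have "s1 ''rk'' (i + (i + i)) = (i + (i + i)) * K"
    using assms(3)[of "i + (i + i)"] 6(1,4) by simp
  then have a: "aval (cell_addr (Sc ''v'') (N 0) (N 0)) s1 = addr K i 0 0"
    using 6(3) by (simp add: cell_addr_def addr_def)
  show ?case
    using 6 by (intro wp_Seq wp_Assign) (auto simp: a addr_inject[OF _ _ _ assms(5)] less_Suc_eq)
qed (use assms in auto)

text \<open>One contribution to \<open>merge\<close>, in terms of cells: \<open>e\<close> edges are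
  attained iff \<open>e\<close> is less than the value of the cell.\<close>

definition combo :: "(nat \<Rightarrow> nat \<Rightarrow> nat) \<Rightarrow> (nat \<Rightarrow> nat \<Rightarrow> nat) \<Rightarrow> nat \<times> nat \<times> nat \<times> nat \<times> nat \<Rightarrow>
    nat \<Rightarrow> nat \<Rightarrow> nat \<Rightarrow> bool" where
  "combo A B = (\<lambda>(d1, j1, d2, j2, u) d j e.
     d = d1 + u \<and> j = j1 + j2 + ((u - d1) + (u - d2)) \<and> d1 + u < 3 \<and> d2 + u < 3 \<and>
     0 < A d1 j1 \<and> 0 < B d2 j2 \<and> e < A d1 j1 + B d2 j2 + u - 1)"

text \<open>Invariant of the five nested loops, with \<open>R\<close> the set of index tuples
  handled so far. The sources are read in the initial state \<open>s\<^sub>0\<close>; they stay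
  intact as long as their numbers differ from \<open>z\<close>.\<close>

definition combined :: "nat \<Rightarrow> state \<Rightarrow> nat \<Rightarrow> nat \<Rightarrow> nat \<Rightarrow> (nat \<times> nat \<times> nat \<times> nat \<times> nat) set \<Rightarrow> state \<Rightarrow> bool" where
  "combined K s\<^sub>0 a c z R s \<longleftrightarrow>
     (\<forall>b d j. b \<noteq> z \<longrightarrow> d < 3 \<longrightarrow> j < K \<longrightarrow> s ''T'' (addr K b d j) = s\<^sub>0 ''T'' (addr K b d j)) \<and>
     (\<forall>d j e. d < 3 \<longrightarrow> j < K \<longrightarrow> e < s ''T'' (addr K z d j) \<longleftrightarrow>
       (\<exists>r \<in> R. combo (\<lambda>d j. s\<^sub>0 ''T'' (addr K a d j)) (\<lambda>d j. s\<^sub>0 ''T'' (addr K c d j)) r d j e))"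

lemma combine_cells_correct:
  assumes inv: "combined K s\<^sub>0 a c z R s"
    and rk: "\<And>q. q \<le> 6 * m \<Longrightarrow> s ''rk'' q = q * K" and K: "K = 3 + 2 * n"
    and acz: "s ''a'' 0 = a" "s ''c'' 0 = c" "s ''z'' 0 = z" "a < 2 * m" "c < 2 * m" "z < 2 * m"
      "a \<noteq> z" "c \<noteq> z"
    and vars: "s ''d1'' 0 = d1" "s ''j1'' 0 = j1" "s ''d2'' 0 = d2" "s ''j2'' 0 = j2" "s ''u'' 0 = u"
      "d1 < 3" "j1 < Suc n" "d2 < 3" "j2 < Suc n" "u < 2"
  shows "wp L combine_cells (combined K s\<^sub>0 a c z (R \<union> {(d1, j1, d2, j2, u)})) s"
proof -
  define x y where "x = s\<^sub>0 ''T'' (addr K a d1 j1)" and "y = s\<^sub>0 ''T'' (addr K c d2 j2)"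
  define j where "j = j1 + j2 + ((u - d1) + (u - d2))"
  define w where "w = addr K z (d1 + u) j"
  define h where "h = x + y + u - 1"
  have less: "j1 < K" "j2 < K" "j < K"
    using vars K by (auto simp: j_def)
  have T: "s ''T'' (addr K a d1 j1) = x" "s ''T'' (addr K c d2 j2) = y"
    using inv acz vars less by (auto simp: combined_def x_def y_def)
  have rows: "s ''rk'' (a + (a + a) + d1) = (a + (a + a) + d1) * K"
    "s ''rk'' (c + (c + c) + d2) = (c + (c + c) + d2) * K"
    "s ''rk'' (z + (z + z) + (d1 + u)) = (z + (z + z) + (d1 + u)) * K"
    using acz vars by (auto intro!: rk)
  have *: "combined K s\<^sub>0 a c z (R \<union> {(d1, j1, d2, j2, u)}) s'"
    if "s' ''T'' = (if 0 < x \<and> 0 < y \<and> d1 + u < 3 \<and> d2 + u < 3 \<and> s ''T'' w < h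
      then (s ''T'')(w := h) else s ''T'')" for s'
  proof -
    let ?combo = "combo (\<lambda>d j. s\<^sub>0 ''T'' (addr K a d j)) (\<lambda>d j. s\<^sub>0 ''T'' (addr K c d j))"
    have combo: "?combo (d1, j1, d2, j2, u) d i e \<longleftrightarrow>
        d = d1 + u \<and> i = j \<and> d1 + u < 3 \<and> d2 + u < 3 \<and> 0 < x \<and> 0 < y \<and> e < h" for d i e
      by (auto simp: combo_def x_def y_def j_def h_def)
    have 1: "s' ''T'' (addr K b d i) = s\<^sub>0 ''T'' (addr K b d i)" if "b \<noteq> z" "d < 3" "i < K" for b d i
    proof -
      have "d1 + u < 3 \<Longrightarrow> addr K b d i \<noteq> w"
        using that less addr_inject[of d "d1 + u" i K j b z] by (auto simp: w_def)
      then show ?thesis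
        using inv that \<open>s' ''T'' = _\<close> by (auto simp: combined_def)
    qed
    have 2: "e < s' ''T'' (addr K z d i) \<longleftrightarrow> (\<exists>r \<in> R \<union> {(d1, j1, d2, j2, u)}. ?combo r d i e)"
      if "d < 3" "i < K" for d i e
    proof -
      have "d1 + u < 3 \<Longrightarrow> addr K z d i = w \<longleftrightarrow> d = d1 + u \<and> i = j"
        using that less addr_inject[of d "d1 + u" i K j z z] by (auto simp: w_def)
      moreover have "e < s ''T'' (addr K z d i) \<longleftrightarrow> (\<exists>r \<in> R. ?combo r d i e)"
        using inv that by (auto simp: combined_def)
      \<comment> \<open>A number is below the maximum of two values iff it is below one of them, so
        storing the maximum adds exactly the new tuple.\<close>
      ultimately have "e < s' ''T'' (addr K z d i) \<longleftrightarrow>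
          (\<exists>r \<in> R. ?combo r d i e) \<or> ?combo (d1, j1, d2, j2, u) d i e"
        unfolding combo \<open>s' ''T'' = _\<close> by (auto simp: w_def)
      then show ?thesis
        by blast
    qed
    show ?thesis
      using 1 2 unfolding combined_def by blast
  qed
  have "wp L combine_cells (\<lambda>s'. s' ''T'' = (if 0 < x \<and> 0 < y \<and> d1 + u < 3 \<and> d2 + u < 3 \<and> s ''T'' w < h
      then (s ''T'')(w := h) else s ''T'')) s"
    unfolding combine_cells_def
    by (intro wp_Seq wp_Assign wp_If wp_Skip)
      (auto simp: cell_addr_def acz vars rows T h_def simp flip: addr_def j_def w_def)
  then show ?thesis
    by (rule wp_frame) (rule *)
qed

text \<open>The result table starts with zeros, which represents the empty set of tuples; after the
  loops, all tuples with \<open>j1\<close> and \<open>j2\<close> at most \<open>n\<close> have been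
  handled.\<close>

lemma combine_tables_correct:
  assumes n: "s ''n'' 0 = n" "Suc n \<le> L" "3 \<le> L" and K: "K = 3 + 2 * n"
    and rk: "\<And>q. q \<le> 6 * m \<Longrightarrow> s ''rk'' q = q * K"
    and acz: "s ''a'' 0 = a" "s ''c'' 0 = c" "s ''z'' 0 = z" "a < 2 * m" "c < 2 * m" "z < 2 * m"
      "a \<noteq> z" "c \<noteq> z"
    and A: "\<And>d j e. d < 3 \<Longrightarrow> j \<le> n \<Longrightarrow> e < s ''T'' (addr K a d j) \<longleftrightarrow> (d, j, e) \<in> A"
    and B: "\<And>d j e. d < 3 \<Longrightarrow> j \<le> n \<Longrightarrow> e < s ''T'' (addr K c d j) \<longleftrightarrow> (d, j, e) \<in> B"
    and Z: "\<And>d j. d < 3 \<Longrightarrow> j < K \<Longrightarrow> s ''T'' (addr K z d j) = 0"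
  shows "wp L combine_tables (\<lambda>s'.
    (\<forall>b d j. b \<noteq> z \<longrightarrow> d < 3 \<longrightarrow> j < K \<longrightarrow> s' ''T'' (addr K b d j) = s ''T'' (addr K b d j)) \<and>
    (\<forall>d j e. d < 3 \<longrightarrow> j \<le> n \<longrightarrow> e < s' ''T'' (addr K z d j) \<longleftrightarrow> (d, j, e) \<in> merge A B)) s"
proof -
  define I where "I = combined K s a c z"
  define R where "R = (\<Union>d1<3. \<Union>j1<Suc n. \<Union>d2<3. \<Union>j2<Suc n. \<Union>u<2. {(d1 :: nat, j1, d2 :: nat, j2, u :: nat)})"
  have I_upd: "I R (s'(x := f))" if "I R s'" "x \<noteq> ''T''" for R s' x f
    using that by (simp add: I_def combined_def)
  have writes: "writes combine_cells = {''x'', ''y'', ''w'', ''h'', ''T''}"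
    by (auto simp: combine_cells_def)
  have "wp L combine_tables (I ({} \<union> R)) s"
    unfolding combine_tables_def R_def
  proof (rule wp_For_accum, goal_cases)
    case 6
    then show ?case
      using Z by (simp add: I_def combined_def)
  next
    case (7 d1 s1 R1)
    note l1 = 7
    show ?case
    proof (rule wp_For_accum, goal_cases)
      case (7 j1 s2 R2)
      note l2 = 7
      show ?case
      proof (rule wp_For_accum, goal_cases)
        case (7 d2 s3 R3)
        note l3 = 7
        show ?case
        proof (rule wp_For_accum, goal_cases)
          case (7 j2 s4 R4)
          note l4 = 7
          show ?case
          proof (rule wp_For_accum, goal_cases)
            case (7 u s5 R5)
            note l5 = 7
            show ?case
              unfolding I_def
              by (rule combine_cells_correct[where n = n and m = m])
                (use K acz rk l1(1,3,4) l2(1,3,4) l3(1,3,4) l4(1,3,4) l5(1,3,4) l5(2)[unfolded I_def]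
                  in \<open>simp_all add: writes\<close>)
          qed ((erule I_upd, simp) | (use n l1 l2 l3 l4 in \<open>simp add: writes\<close>))+
        qed ((erule I_upd, simp) | (use n l1 l2 l3 in \<open>simp add: writes\<close>))+
      qed ((erule I_upd, simp) | (use n l1 l2 in \<open>simp add: writes\<close>))+
    qed ((erule I_upd, simp) | (use n l1 in \<open>simp add: writes\<close>))+
  qed ((erule I_upd, simp) | (use n in \<open>simp add: writes\<close>))+
  then show ?thesis
  proof (rule wp_frame, goal_cases)
    case (1 s')
    let ?combo = "combo (\<lambda>d j. s ''T'' (addr K a d j)) (\<lambda>d j. s ''T'' (addr K c d j))"
    have "(\<exists>r \<in> R. ?combo r d j e) \<longleftrightarrow> (d, j, e) \<in> merge A B" if "d < 3" "j \<le> n" for d j e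
    proof
      assume "\<exists>r \<in> R. ?combo r d j e"
      then obtain d1 j1 d2 j2 u where r: "d1 < 3" "j1 < Suc n" "d2 < 3" "j2 < Suc n" "u < 2"
        "?combo (d1, j1, d2, j2, u) d j e"
        by (auto simp: R_def)
      let ?x = "s ''T'' (addr K a d1 j1)" and ?y = "s ''T'' (addr K c d2 j2)"
      have pos: "0 < ?x" "0 < ?y" "d1 + u < 3" "d2 + u < 3" "e < ?x + ?y + u - 1"
        "d = d1 + u" "j = j1 + j2 + (u - d1) + (u - d2)"
        using r(6) by (simp_all add: combo_def)
      \<comment> \<open>The largest numbers of edges that the two cells stand for.\<close>
      have "(d1, j1, ?x - 1) \<in> A" "(d2, j2, ?y - 1) \<in> B"
        using A[of d1 j1 "?x - 1"] B[of d2 j2 "?y - 1"] r(1-4) pos(1,2) by simp_all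
      then show "(d, j, e) \<in> merge A B"
        using mergeI[of d1 j1 "?x - 1" A d2 j2 "?y - 1" B u e] r(5) pos by simp
    next
      assume "(d, j, e) \<in> merge A B"
      then obtain d1 j1 e1 d2 j2 e2 u where r: "(d1, j1, e1) \<in> A" "(d2, j2, e2) \<in> B" "u \<le> 1"
        "d1 + u \<le> 2" "d2 + u \<le> 2" "e \<le> e1 + e2 + u" "d = d1 + u" "j = j1 + j2 + (u - d1) + (u - d2)"
        unfolding merge_def by auto
      \<comment> \<open>\<open>j1\<close> and \<open>j2\<close> are summands of
        \<open>j \<le> n\<close>, so the restriction of the loops to \<open>n\<close> loses
        nothing.\<close>
      have "e1 < s ''T'' (addr K a d1 j1)" "e2 < s ''T'' (addr K c d2 j2)"
        using A[of d1 j1 e1] B[of d2 j2 e2] r that by simp_all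
      then have "?combo (d1, j1, d2, j2, u) d j e"
        using r by (simp add: combo_def)
      moreover have "(d1, j1, d2, j2, u) \<in> R"
        using r that by (simp add: R_def)
      ultimately show "\<exists>r \<in> R. ?combo r d j e"
        by blast
    qed
    then show ?case
      using 1(1) K by (auto simp: I_def combined_def)
  qed
qed

text \<open>After \<open>t\<close> merges the tables in use have numbers below \<open>m\<close>
  (initial ones) or from \<open>2 * m - t\<close> on (results), and those in between are still zero.
  The next result gets the number \<open>2 * m - Suc t\<close>, just below the results so
  far.\<close>

lemma process_tree_correct:
  assumes m: "s ''m'' 0 = m" "0 < m" "m \<le> L" and n: "s ''n'' 0 = n" "Suc n \<le> L" "3 \<le> L"
    and K: "K = 3 + 2 * n" and rk: "\<And>q. q \<le> 6 * m \<Longrightarrow> s ''rk'' q = q * K"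
    and par: "\<And>k. 0 < k \<Longrightarrow> k < m \<Longrightarrow> s ''par'' k < k"
    and cur: "\<And>v. v < m \<Longrightarrow> s ''cur'' v = v"
    and T: "\<And>a d j. d < 3 \<Longrightarrow> j < K \<Longrightarrow>
      s ''T'' (addr K a d j) = (if a < m \<and> d = 0 \<and> j = 0 then 1 else 0)"
  shows "wp L process_tree (\<lambda>s'. s' ''cur'' 0 < 2 * m \<and> (\<forall>d j e. d < 3 \<longrightarrow> j \<le> n \<longrightarrow>
    e < s' ''T'' (addr K (s' ''cur'' 0) d j) \<longleftrightarrow> (d, j, e) \<in> tables (s ''par'') m (m - 1) 0)) s"
proof -
  define par where "par = s ''par''"
  define J where "J = (\<lambda>t (s' :: state).
    (\<forall>v < m - t. (s' ''cur'' v < m \<or> 2 * m - t \<le> s' ''cur'' v) \<and> s' ''cur'' v < 2 * m \<and>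
      (\<forall>d j e. d < 3 \<longrightarrow> j \<le> n \<longrightarrow>
        e < s' ''T'' (addr K (s' ''cur'' v) d j) \<longleftrightarrow> (d, j, e) \<in> tables par m t v)) \<and>
    (\<forall>b d j. m \<le> b \<longrightarrow> b < 2 * m - t \<longrightarrow> d < 3 \<longrightarrow> j < K \<longrightarrow> s' ''T'' (addr K b d j) = 0))"
  show ?thesis
    unfolding process_tree_def
  proof (rule wp_For[where I = J and n = "m - 1"], goal_cases)
    case 5
    \<comment> \<open>A cell with value 1 admits only \<open>e = 0\<close>, in agreement with the
      entry \<open>(0, 0, 0)\<close>.\<close>
    have "J 0 s"
      using T cur K by (auto simp: J_def)
    then show ?case
      by (simp add: J_def)
  next
    case (6 t s1)
    define i where "i = m - Suc t"
    define p where "p = par i"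
    define a where "a = s1 ''cur'' p"
    define c where "c = s1 ''cur'' i"
    define z where "z = m + i"
    have i: "0 < i" "i < m" "m - t = Suc i" "2 * m - t = Suc z"
      using 6(1) by (auto simp: i_def z_def)
    have p: "p < i"
      using par[OF i(1,2)] unfolding p_def local.par_def .
    have same: "s1 ''par'' = par" "s1 ''m'' = s ''m''" "s1 ''n'' = s ''n''" "s1 ''rk'' = s ''rk''"
      using 6(4) by (simp_all add: par_def combine_tables_def combine_cells_def)
    have J: "\<And>v. v < Suc i \<Longrightarrow> s1 ''cur'' v < 2 * m" "\<And>v. v < Suc i \<Longrightarrow> s1 ''cur'' v \<noteq> z"
      "\<And>v. v < Suc i \<Longrightarrow> s1 ''cur'' v < m \<or> Suc z \<le> s1 ''cur'' v"
      "\<And>v d j e. v < Suc i \<Longrightarrow> d < 3 \<Longrightarrow> j \<le> n \<Longrightarrow>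
        e < s1 ''T'' (addr K (s1 ''cur'' v) d j) \<longleftrightarrow> (d, j, e) \<in> tables par m t v"
      "\<And>b d j. m \<le> b \<Longrightarrow> b < Suc z \<Longrightarrow> d < 3 \<Longrightarrow> j < K \<Longrightarrow> s1 ''T'' (addr K b d j) = 0"
      using 6(2) unfolding J_def i(3,4) z_def by (force, force, force, blast, blast)
    define s2 where "s2 = s1(''i'' := (s1 ''i'')(0 := i), ''p'' := (s1 ''p'')(0 := p),
      ''a'' := (s1 ''a'')(0 := a), ''c'' := (s1 ''c'')(0 := c), ''z'' := (s1 ''z'')(0 := z))"
    have "wp L combine_tables (\<lambda>s'.
      (\<forall>b d j. b \<noteq> z \<longrightarrow> d < 3 \<longrightarrow> j < K \<longrightarrow> s' ''T'' (addr K b d j) = s2 ''T'' (addr K b d j)) \<and>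
      (\<forall>d j e. d < 3 \<longrightarrow> j \<le> n \<longrightarrow>
        e < s' ''T'' (addr K z d j) \<longleftrightarrow> (d, j, e) \<in> merge (tables par m t p) (tables par m t i))) s2"
    proof (rule combine_tables_correct[where n = n and m = m and a = a and c = c])
      show "a < 2 * m" "c < 2 * m" "a \<noteq> z" "c \<noteq> z"
        using J(1,2)[of p] J(1,2)[of i] p by (simp_all add: a_def c_def)
      show "z < 2 * m"
        using i by (simp add: z_def)
      show "e < s2 ''T'' (addr K a d j) \<longleftrightarrow> (d, j, e) \<in> tables par m t p" if "d < 3" "j \<le> n" for d j e
        using J(4)[OF _ that, of p] p by (simp add: s2_def a_def)
      show "e < s2 ''T'' (addr K c d j) \<longleftrightarrow> (d, j, e) \<in> tables par m t i" if "d < 3" "j \<le> n" for d j e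
        using J(4)[OF _ that, of i] by (simp add: s2_def c_def)
      show "s2 ''T'' (addr K z d j) = 0" if "d < 3" "j < K" for d j
        using J(5)[OF _ _ that, of z] by (simp add: s2_def z_def)
    qed (use n K rk in \<open>simp_all add: s2_def same\<close>)
    then have comb: "wp L combine_tables (wp L (Assign ''cur'' (Sc ''p'') (Sc ''z''))
      (\<lambda>s'. J (Suc t) (s'(''t'' := (s' ''t'')(0 := Suc t))))) s2"
    proof (rule wp_frame, intro wp_Assign, goal_cases)
      case (1 s3)
      have s3: "s3 ''p'' 0 = p" "s3 ''z'' 0 = z" "s3 ''cur'' = s1 ''cur''"
        using 1(2) by (simp_all add: s2_def combine_tables_def combine_cells_def)
      have old: "s3 ''T'' (addr K b d j) = s1 ''T'' (addr K b d j)" if "b \<noteq> z" "d < 3" "j < K" for b d j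
        using 1(1) that by (simp add: s2_def)
      have new: "e < s3 ''T'' (addr K z d j) \<longleftrightarrow> (d, j, e) \<in> merge (tables par m t p) (tables par m t i)"
        if "d < 3" "j \<le> n" for d j e
        using 1(1) that by simp
      have tab: "tables par m (Suc t) = (tables par m t)(p := merge (tables par m t p) (tables par m t i))"
        by (simp add: Let_def i_def p_def)
      define cur' where "cur' = (s1 ''cur'')(p := z)"
      have "(cur' v < m \<or> z \<le> cur' v) \<and> cur' v < 2 * m \<and> (\<forall>d j e. d < 3 \<longrightarrow> j \<le> n \<longrightarrow>
          e < s3 ''T'' (addr K (cur' v) d j) \<longleftrightarrow> (d, j, e) \<in> tables par m (Suc t) v)" if "v < i" for v
      proof (cases "v = p")
        case True
        then show ?thesis
          using i new by (simp add: cur'_def tab z_def del: tables.simps)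
      next
        case False
        then show ?thesis
          using J(1-3)[of v] J(4)[of v] old[of "s1 ''cur'' v"] \<open>v < i\<close> K by (auto simp: cur'_def tab simp del: tables.simps)
      qed
      moreover have "s3 ''T'' (addr K b d j) = 0" if "m \<le> b" "b < z" "d < 3" "j < K" for b d j
        using J(5)[of b d j] old[of b d j] that by simp
      moreover have "m - Suc t = i" "2 * m - Suc t = z"
        using i by auto
      ultimately have "J (Suc t) s'" if "s' ''T'' = s3 ''T''" "s' ''cur'' = cur'" for s'
        unfolding J_def that by simp
      note J_Suc = this
      show ?case
        by (rule J_Suc) (simp_all add: s3 cur'_def)
    qed
    show ?case
    proof (intro wp_Seq wp_Assign, goal_cases)
      case 1
      have "m - Suc 0 - t = i"
        by (simp add: i_def)
      then show ?case
        using comb m(1) 6(3) by (simp add: s2_def same p_def a_def c_def z_def)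
    qed
  next
    case (7 s1)
    have "m - (m - 1) = 1"
      using m(2) by simp
    then show ?case
      using 7(1) by (simp add: J_def par_def)
  qed (use m in \<open>simp_all add: combine_tables_def combine_cells_def\<close>)
qed

text \<open>A maximum is treated as a union of initial segments \<open>{..<x}\<close>, which makes
  the search for it an instance of \<open>wp_For_accum\<close>.\<close>

lemma find_best_correct:
  assumes n: "s ''n'' 0 = n" "Suc n \<le> L" "3 \<le> L" and m: "s ''m'' 0 = m"
    and rk: "\<And>q. q \<le> 6 * m \<Longrightarrow> s ''rk'' q = q * K"
    and a: "s ''cur'' 0 = a" "a < 2 * m" and best: "s ''best'' 0 = 0"
  shows "wp L find_best (\<lambda>s'. \<exists>best.
    (\<forall>e. e < best \<longleftrightarrow> (\<exists>d < 3. \<exists>j < Suc n. e < s ''T'' (addr K a d j))) \<and>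
    s' ''out'' 0 = n + m - best - best) s"
proof -
  define s0 where "s0 = s(''a'' := (s ''a'')(0 := a))"
  let ?body = "''x'' ::= Acc ''T'' (cell_addr (Sc ''a'') (Sc ''d1'') (Sc ''j1'')) ;;
       If (Less (Sc ''best'') (Sc ''x'')) (''best'' ::= Sc ''x'') Skip"
  define I where "I = (\<lambda>(R :: nat set) (s' :: state). \<forall>e. e < s' ''best'' 0 \<longleftrightarrow> e \<in> R)"
  have I_upd: "I R (s'(x := f))" if "I R s'" "x \<noteq> ''best''" for R s' x f
    using that by (simp add: I_def)
  have body: "wp L ?body (I (R \<union> {..<s ''T'' (addr K a d j)})) s2"
    if "d < 3" "I R s2" "s2 ''d1'' 0 = d" "s2 ''j1'' 0 = j"
      "\<And>y. y \<notin> {''d1'', ''j1'', ''x'', ''best''} \<Longrightarrow> s2 y = s0 y" for R d j s2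
  proof -
    have "s2 ''rk'' (a + (a + a) + d) = (a + (a + a) + d) * K"
      using that a rk by (simp add: s0_def)
    moreover have "s2 ''a'' 0 = a" "s2 ''T'' = s ''T''"
      using that by (simp_all add: s0_def)
    moreover have "I (R \<union> {..<s ''T'' (addr K a d j)}) s'"
      if "s' ''best'' 0 = max (s2 ''best'' 0) (s ''T'' (addr K a d j))" for s'
      using that \<open>I R s2\<close> by (simp add: I_def less_max_iff_disj)
    ultimately show ?thesis
      using that(3,4)
      by (intro wp_Seq wp_Assign wp_If wp_Skip) (simp_all add: cell_addr_def flip: addr_def)
  qed
  have "wp L (For ''d1'' (N 3) (For ''j1'' (Plus (Sc ''n'') (N 1)) ?body))
      (I ({} \<union> (\<Union>d<3. \<Union>j<Suc n. {..<s ''T'' (addr K a d j)}))) s0"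
  proof (rule wp_For_accum, goal_cases)
    case (7 d s1 R1)
    note l1 = 7
    show ?case
    proof (rule wp_For_accum, goal_cases)
      case (7 j s2 R2)
      then show ?case
        using l1 by (intro body) simp_all
    qed ((erule I_upd, simp) | (use n l1 in \<open>simp add: s0_def\<close>))+
  qed ((erule I_upd, simp) | (use n best in \<open>simp add: s0_def I_def\<close>))+
  then have loop: "wp L (For ''d1'' (N 3) (For ''j1'' (Plus (Sc ''n'') (N 1)) ?body))
    (wp L (''out'' ::= Minus (Minus (Plus (Sc ''n'') (Sc ''m'')) (Sc ''best'')) (Sc ''best''))
      (\<lambda>s'. \<exists>best. (\<forall>e. e < best \<longleftrightarrow> (\<exists>d < 3. \<exists>j < Suc n. e < s ''T'' (addr K a d j))) \<and>
        s' ''out'' 0 = n + m - best - best)) s0"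
  proof (rule wp_frame, intro wp_Assign, goal_cases)
    case (1 s3)
    have "s3 ''n'' 0 = n" "s3 ''m'' 0 = m"
      using 1(2) n m by (simp_all add: s0_def)
    then show ?case
      using 1(1) by (intro exI[of _ "s3 ''best'' 0"]) (auto simp: I_def)
  qed
  show ?thesis
    unfolding find_best_def using loop a
    by (intro wp_Seq wp_Assign) (simp add: s0_def)
qed

text \<open>After \<open>m - 1\<close> merges only the root is left, so the sums over unmerged
  vertices have a single term and the tables speak about the whole tree.\<close>

lemma best_of_tables:
  assumes m: "0 < m" and par: "\<And>k. 0 < k \<Longrightarrow> k < m \<Longrightarrow> par k < k"
    and T: "\<And>d j e. d < 3 \<Longrightarrow> j \<le> n \<Longrightarrow> e < T d j \<longleftrightarrow> (d, j, e) \<in> tables par m (m - 1) 0"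
  shows "(\<exists>d < 3. \<exists>j < Suc n. e < T d j) \<longleftrightarrow>
    (\<exists>X \<subseteq> {1..<m}. linear_forest par X \<and> card (supp par X) \<le> n \<and> e \<le> card X)"
proof
  assume "\<exists>d < 3. \<exists>j < Suc n. e < T d j"
  then obtain d j where dj: "d < 3" "j \<le> n" "(d, j, e) \<in> tables par m (m - 1) 0"
    using T by (auto simp: less_Suc_eq_le)
  then have "\<exists>X \<subseteq> {m - (m - 1)..<m}. linear_forest par X \<and> (\<forall>v < m - (m - 1). edge_degree par X v = d) \<and>
      card (supp par X) = sum (\<lambda>_. j) {..<m - (m - 1)} \<and> sum (\<lambda>_. e) {..<m - (m - 1)} \<le> card X"
    using m by (intro tables_sound par) auto
  then show "\<exists>X \<subseteq> {1..<m}. linear_forest par X \<and> card (supp par X) \<le> n \<and> e \<le> card X"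
    using m dj(2) by auto
next
  assume "\<exists>X \<subseteq> {1..<m}. linear_forest par X \<and> card (supp par X) \<le> n \<and> e \<le> card X"
  then obtain X where X: "X \<subseteq> {1..<m}" "linear_forest par X" "card (supp par X) \<le> n" "e \<le> card X"
    by blast
  have "m - (m - 1) = 1"
    using m by simp
  then obtain j f where jf: "(edge_degree par X 0, j 0, f 0) \<in> tables par m (m - 1) 0"
    "j (0 :: nat) = card (supp par X)" "f (0 :: nat) = card X"
    using tables_complete[where m = m and par = par and t = "m - 1" and X = X, OF par] X(1,2) m by auto
  moreover have "edge_degree par X 0 < 3"
    using X(2) by (simp add: linear_forest_def less_Suc_eq_le numeral_3_eq_3 numeral_2_eq_2)
  ultimately have "edge_degree par X 0 < 3 \<and> card (supp par X) < Suc n \<and>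
      e < T (edge_degree par X 0) (card (supp par X))"
    using T[of "edge_degree par X 0" "card (supp par X)" "card X"] X(3,4) by simp
  then show "\<exists>d < 3. \<exists>j < Suc n. e < T d j"
    by blast
qed

section \<open>The encoded input and the whole program\<close>

lemma concat_rows:
  shows "length (concat (map (\<lambda>u. map (f u) [0..<n]) [0..<k])) = k * n"
    and "u < k \<Longrightarrow> v < n \<Longrightarrow> concat (map (\<lambda>u. map (f u) [0..<n]) [0..<k]) ! (u * n + v) = f u v"
proof (induction k)
  case (Suc k)
  {
    case 1
    then show ?case
      using Suc(1) by simp
  next
    case 2
    show ?case
    proof (cases "u = k")
      case True
      then show ?thesis
        using Suc(1) 2 by (simp add: nth_append)
    next
      case False
      then have "Suc u * n \<le> k * n"
        using 2 by (intro mult_le_mono1) simp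
      then have "u * n + v < k * n"
        using 2 by simp
      then show ?thesis
        using Suc 2 False by (simp add: nth_append)
    qed
  }
qed auto

lemma length_encode_graph: "length (encode_graph code G) = 1 + card (verts G) + card (verts G) * card (verts G)"
  by (simp add: encode_graph_def Let_def concat_rows(1))

lemma encode_graph_size: "encode_graph code G ! 0 = card (verts G)"
  by (simp add: encode_graph_def Let_def)

text \<open>Edges are coded by successors, so a test for positivity decides adjacency whatever the
  labels are.\<close>

lemma encode_graph_edge:
  assumes "u < card (verts G)" "v < card (verts G)"
  shows "0 < encode_graph code G ! (1 + card (verts G) + (u * card (verts G) + v)) \<longleftrightarrow> {u, v} \<in> edges G"
  using assms concat_rows(2)[of u "card (verts G)" v "card (verts G)"
      "\<lambda>u v. if {u, v} \<in> edges G then Suc (code (elab G {u, v})) else 0"]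
  by (simp add: encode_graph_def Let_def nth_append)

lemma ged_program_correct:
  fixes G H :: "(nat, 'l) lgraph" and code :: "'l \<Rightarrow> nat"
  assumes C: "counts_edge_edits C" and GH: "(G, H) \<in> path_tree_pairs"
  defines "w \<equiv> encode_pair code (G, H)"
  shows "wp (6 * length w + 6) ged_program (\<lambda>s. of_nat (s ''out'' 0) = GED G H C) (input_state w)"
proof -
  define n m where "n = card (verts G)" and "m = card (verts H)"
  \<comment> \<open>The largest loop bounds are \<open>6 * m\<close> and \<open>n + 1\<close>; the
    length of \<open>w\<close> is at least \<open>n + m + 2\<close>.\<close>
  define L where "L = 6 * length w + 6"
  define K where "K = 3 + 2 * n"
  define E where "E = (\<lambda>u v. {u, v} \<in> edges H)"
  have G: "is_graph G" "is_path G" and H: "is_graph H" "is_tree H" and verts: "verts H = {..<m}"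
    using GH by (auto simp: path_tree_pairs_def input_graph_def m_def)
  have conn: "connected_graph H"
    using H(2) by (simp add: is_tree_def)
  then have m: "0 < m"
    using verts by (auto simp: connected_graph_def)
  have w: "w = encode_graph code G @ encode_graph code H"
    by (simp add: w_def)
  have lenG: "length (encode_graph code G) = 1 + n + n * n"
    and lenH: "length (encode_graph code H) = 1 + m + m * m"
    by (simp_all add: length_encode_graph n_def m_def)
  have len: "length w = 2 + n + n * n + m + m * m"
    by (simp add: w lenG lenH)
  have L: "n \<le> L" "m \<le> L" "Suc n \<le> L" "3 \<le> L" "m + m + (m + m) + (m + m) \<le> L"
    by (simp_all add: L_def len)
  define s0 where "s0 = input_state w"
  have in_w: "s0 ''in'' i = (if i < length w then w ! i else 0)" for i
    by (simp add: s0_def input_state_def)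
  have zero: "s0 x i = 0" if "x \<noteq> ''in''" "x \<noteq> ''len''" for x i
    using that by (simp add: s0_def input_state_def)
  have in0: "s0 ''in'' 0 = n"
    by (simp add: in_w len) (simp add: w nth_append lenG encode_graph_size n_def)
  have sq0: "s0 ''sq'' 0 = 0"
    by (simp add: zero)
  have inm: "s0 ''in'' (1 + n + n * n) = m"
    by (simp add: in_w len) (simp add: w nth_append lenG encode_graph_size m_def)
  have adj: "0 < s0 ''in'' (2 + n + n * n + m + (u * m + v)) \<longleftrightarrow> E u v" if "u < m" "v < m" for u v
  proof -
    have "Suc u * m \<le> m * m"
      using that by (intro mult_le_mono1) simp
    then have "u * m + v < m * m"
      using that by simp
    then have "s0 ''in'' (2 + n + n * n + m + (u * m + v)) =
        encode_graph code H ! (1 + m + (u * m + v))"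
      by (simp add: in_w len) (simp add: w nth_append lenG)
    then show ?thesis
      using encode_graph_edge[of u H v code] that by (simp add: E_def m_def)
  qed
  have crossing: "\<exists>p \<in> W. \<exists>v < m. v \<notin> W \<and> E p v" if W: "W \<subseteq> {..<m}" "W \<noteq> {}" "W \<noteq> {..<m}" for W
  proof -
    obtain p v where "p \<in> W" "v \<in> verts H - W" "{p, v} \<in> edges H"
      by (rule connected_crossing_edge[OF conn _ _ _ H(1), of W]) (use W verts in auto)
    then show ?thesis
      by (auto simp: E_def verts)
  qed
  have "wp L ged_program (\<lambda>s. of_nat (s ''out'' 0) = GED G H C) s0"
    unfolding ged_program_def
  proof (rule wp_Seq, rule wp_frame[OF read_sizes_correct[OF in0 inm sq0 L(1)]], goal_cases)
    case (1 s1)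
    have s1: "s1 ''n'' 0 = n" "s1 ''m'' 0 = m" "s1 ''b'' 0 = 2 + n + n * n + m" "s1 ''K'' 0 = K"
      using 1(1) by (simp_all add: K_def)
    have f1: "s1 y = s0 y" if "y \<notin> {''n'', ''i'', ''sq'', ''m'', ''b'', ''K''}" for y
      using 1(2) that by (simp add: read_sizes_def)
    have mult_rm: "wp L (multiples ''rm'' ''m'' (Sc ''m'')) (\<lambda>s'. \<forall>q \<le> m. s' ''rm'' q = q * s1 ''m'' 0) s1"
      by (rule multiples_correct) (use L s1 in \<open>simp_all add: f1 zero\<close>)
    show ?case
    proof (rule wp_Seq, rule wp_frame[OF mult_rm], goal_cases)
      case (1 s2)
      have f2: "s2 y = s1 y" if "y \<notin> {''rm'', ''i''}" for y
        using 1(2) that by (simp add: multiples_def)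
      have rm: "s2 ''rm'' q = q * m" if "q \<le> m" for q
        using 1(1) that s1 by simp
      let ?bnd = "Plus (Plus (Plus (Sc ''m'') (Sc ''m'')) (Plus (Sc ''m'') (Sc ''m'')))
        (Plus (Sc ''m'') (Sc ''m''))"
      have mult_rk: "wp L (multiples ''rk'' ''K'' ?bnd) (\<lambda>s'. \<forall>q \<le> m + m + (m + m) + (m + m).
          s' ''rk'' q = q * s2 ''K'' 0) s2"
        by (rule multiples_correct) (use L s1 in \<open>simp_all add: f1 f2 zero\<close>)
      show ?case
      proof (rule wp_Seq, rule wp_frame[OF mult_rk], goal_cases)
        case (1 s3)
        have f3: "s3 y = s2 y" if "y \<notin> {''rk'', ''i''}" for y
          using 1(2) that by (simp add: multiples_def)
        have rk: "s3 ''rk'' q = q * K" if "q \<le> 6 * m" for q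
          using 1(1) that s1 f2 by simp
        have order: "wp L find_order (\<lambda>s'. inj_on (s' ''ord'') {..<m} \<and> (\<forall>k < m. s' ''ord'' k < m) \<and>
            (\<forall>k. 0 < k \<longrightarrow> k < m \<longrightarrow> s' ''par'' k < k \<and> E (s' ''ord'' (s' ''par'' k)) (s' ''ord'' k))) s3"
          by (rule find_order_correct[where m = m, OF _ m L(2) _ _ _ crossing])
            (use s1 adj in \<open>simp_all add: f1 f2 f3 zero rm\<close>)
        show ?case
        proof (rule wp_Seq, rule wp_frame[OF order], goal_cases)
          case (1 s4)
          have f4: "s4 y = s3 y" if "y \<notin> {''vis'', ''i'', ''v'', ''k'', ''c'', ''q'', ''ord'', ''par''}" for y
            using 1(2) that by (simp add: find_order_def)
          define ord where "ord = s4 ''ord''"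
          define par where "par = s4 ''par''"
          have par: "\<And>k. 0 < k \<Longrightarrow> k < m \<Longrightarrow> par k < k"
            using 1(1) by (simp add: par_def)
          have "inj_on ord {..<m}" "ord ` {..<m} \<subseteq> {..<m}"
            using 1(1) by (auto simp: ord_def)
          then have ord: "bij_betw ord {..<m} (verts H)"
            unfolding bij_betw_def verts by (simp add: endo_inj_surj)
          have sub: "parent_edges ord par m \<subseteq> edges H"
            using 1(1) by (auto simp: parent_edges_def ord_def par_def E_def insert_commute)
          have edges: "edges H = parent_edges ord par m"
            by (rule tree_edges_eq_parent_edges[OF H(2) ord _ sub]) (rule par)
          have init: "wp L init_tables (\<lambda>s'. (\<forall>v < m. s' ''cur'' v = v) \<and> (\<forall>a d j. d < 3 \<longrightarrow> j < K \<longrightarrow>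
              s' ''T'' (addr K a d j) = (if a < m \<and> d = 0 \<and> j = 0 then 1 else 0))) s4"
            by (rule init_tables_correct[OF _ L(2)]) (use s1 rk in \<open>simp_all add: f1 f2 f3 f4 zero K_def\<close>)
          show ?case
          proof (rule wp_Seq, rule wp_frame[OF init], goal_cases)
            case (1 s5)
            have f5: "s5 y = s4 y" if "y \<notin> {''v'', ''T'', ''cur''}" for y
              using 1(2) that by (simp add: init_tables_def)
            have proc: "wp L process_tree (\<lambda>s'. s' ''cur'' 0 < 2 * m \<and> (\<forall>d j e. d < 3 \<longrightarrow> j \<le> n \<longrightarrow>
                e < s' ''T'' (addr K (s' ''cur'' 0) d j) \<longleftrightarrow> (d, j, e) \<in> tables (s5 ''par'') m (m - 1) 0)) s5"
              by (rule process_tree_correct[OF _ m L(2) _ L(3,4) K_def])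
                (use 1(1) s1 rk par in \<open>simp_all add: f1 f2 f3 f4 f5 par_def\<close>)
            show ?case
            proof (rule wp_Seq, rule wp_frame[OF proc], goal_cases)
              case (1 s6)
              have f6: "s6 y = s5 y" if "y \<notin> {''t'', ''i'', ''p'', ''a'', ''c'', ''z'', ''cur'', ''d1'', ''j1'',
                  ''d2'', ''j2'', ''u'', ''x'', ''y'', ''w'', ''h'', ''T''}" for y
                using 1(2) that by (simp add: process_tree_def combine_tables_def combine_cells_def)
              have best: "wp L find_best (\<lambda>s'. \<exists>best.
                  (\<forall>e. e < best \<longleftrightarrow> (\<exists>d < 3. \<exists>j < Suc n. e < s6 ''T'' (addr K (s6 ''cur'' 0) d j))) \<and>
                  s' ''out'' 0 = n + m - best - best) s6"
                by (rule find_best_correct[OF _ L(3,4)])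
                  (use 1(1) s1 rk in \<open>simp_all add: f1 f2 f3 f4 f5 f6 zero\<close>)
              note tab = 1(1)
              show ?case
              proof (rule wp_frame[OF best], elim exE conjE, goal_cases)
                case (1 s7 best)
                have "GED G H C = of_nat (card (verts G) + m - best - best)"
                proof (rule GED_path_tree[OF C G ord edges _ m])
                  show "par k < k" if "0 < k" "k < m" for k
                    using par that .
                  fix e
                  show "e < best \<longleftrightarrow> (\<exists>X\<subseteq>{1..<m}. linear_forest par X \<and>
                      card (supp par X) \<le> card (verts G) \<and> e \<le> card X)"
                    unfolding n_def[symmetric] 1(2)[rule_format]
                    by (rule best_of_tables[OF m]) (use par tab in \<open>simp_all add: f5 par_def\<close>)
                qed
                then show ?case
                  using 1(3) by (simp add: n_def)
              qed
            qed
          qed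
        qed
      qed
    qed
  qed
  then show ?thesis
    by (simp add: L_def s0_def)
qed

theorem mainTheorem5:
  fixes A :: "nat set"
  assumes "finite A"
  shows
    "poly_time_computable (encode_pair (\<lambda>_::unit. 0)) path_tree_pairs
       (\<lambda>(G\<^sub>1, G\<^sub>2). GED G\<^sub>1 G\<^sub>2 C_E) \<and>
     poly_time_computable (encode_pair (\<lambda>a::nat. a))
       {(G\<^sub>1, G\<^sub>2) \<in> path_tree_pairs. labels G\<^sub>1 \<subseteq> A \<and> labels G\<^sub>2 \<subseteq> A}
       (\<lambda>(G\<^sub>1, G\<^sub>2). GED G\<^sub>1 G\<^sub>2 C_E_free_relabeling)"
proof
  \<comment> \<open>One program serves both claims, since it never inspects labels and both cost
    functions merely count edge edits.\<close>
  show "poly_time_computable (encode_pair (\<lambda>_::unit. 0)) path_tree_pairs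
      (\<lambda>(G\<^sub>1, G\<^sub>2). GED G\<^sub>1 G\<^sub>2 C_E)"
    by (rule poly_time_computableI[where k = 6 and l = 6 and c = ged_program])
      (use ged_program_correct[OF counts_edge_edits_C_E] in auto)
  show "poly_time_computable (encode_pair (\<lambda>a::nat. a))
      {(G\<^sub>1, G\<^sub>2) \<in> path_tree_pairs. labels G\<^sub>1 \<subseteq> A \<and> labels G\<^sub>2 \<subseteq> A}
      (\<lambda>(G\<^sub>1, G\<^sub>2). GED G\<^sub>1 G\<^sub>2 C_E_free_relabeling)"
    by (rule poly_time_computableI[where k = 6 and l = 6 and c = ged_program])
      (use ged_program_correct[OF counts_edge_edits_C_E_free_relabeling] in auto)
qed

end
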